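(* Let $\delta\in(0,\tfrac12)$. For every (arbitrarily small) $d>0$ there exist integers $\tilde r(m,d)$, $0\le\tilde r(m,d)\le m$, and a constant $c>0$ such that the limit $\lim_{m\to\infty}\binom{m}{\le\tilde r(m,d)}/2^m$ exists and satisfies \[\lim_{m\to\infty}\frac{\binom{m}{\le\tilde r(m,d)}}{2^m}\ge(1-d)(1-h(\delta)),\] and $a_{m,\tilde r(m,d)}\le 2^{-c\sqrt m}\,2^m$ for all sufficiently large $m$.
   Context: $h(\delta)=-\delta\log_2\delta-(1-\delta)\log_2(1-\delta)$ and $\binom{m}{\le r}=\sum_{i=0}^r\binom{m}{i}$. Every function $\mathbb{F}_2^m\to\mathbb{F}_2$ is uniquely a multilinear polynomial $\sum_{S\subseteq[m]}c_Sx_S$, $x_S=\prod_{i\in S}x_i$. Let $Z=(Z_x)_{x\in\mathbb{F}_2^m}$ have i.i.d. Bernoulli$(\delta)$ entries and let $W^{(m)}=(W_S)_{S\subseteq[m]}$ be the coefficient vector of the multilinear polynomial whose evaluation table is $Z$; $W^{(m)}_{\le r}=(W_S)_{|S|\le r}$, $W^{(m)}_{>r}=(W_S)_{|S|>r}$. Define $a_{m,r}:=H(W^{(m)}_{\le r}\mid W^{(m)}_{>r})$ (base-2 conditional Shannon entropy). *)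

theory Defs
  imports "HOL-Analysis.Analysis" "HOL-Library.Z2"
begin

definition bin_entropy :: "real \<Rightarrow> real" where
  "bin_entropy \<delta> = - \<delta> * log 2 \<delta> - (1 - \<delta>) * log 2 (1 - \<delta>)"

definition binom_le :: "nat \<Rightarrow> nat \<Rightarrow> nat" where
  "binom_le m r = (\<Sum>i\<le>r. m choose i)"

text \<open>Points of F_2^m, as functions nat => bit vanishing at coordinates >= m.\<close>
definition points :: "nat \<Rightarrow> (nat \<Rightarrow> bit) set" where
  "points m = {x. \<forall>i\<ge>m. x i = 0}"

definition mlpoly_eval :: "nat \<Rightarrow> (nat set \<Rightarrow> bit) \<Rightarrow> (nat \<Rightarrow> bit) \<Rightarrow> bit" where
  "mlpoly_eval m c x = (\<Sum>S\<in>Pow {..<m}. c S * (\<Prod>i\<in>S. x i))"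

definition ml_coeffs :: "nat \<Rightarrow> ((nat \<Rightarrow> bit) \<Rightarrow> bit) \<Rightarrow> (nat set \<Rightarrow> bit)" where
  "ml_coeffs m Z = (THE c. (\<forall>S. S \<notin> Pow {..<m} \<longrightarrow> c S = 0) \<and>
                           (\<forall>x\<in>points m. mlpoly_eval m c x = Z x))"

definition configs :: "nat \<Rightarrow> ((nat \<Rightarrow> bit) \<Rightarrow> bit) set" where
  "configs m = points m \<rightarrow>\<^sub>E (UNIV :: bit set)"

definition probZ :: "real \<Rightarrow> nat \<Rightarrow> ((nat \<Rightarrow> bit) \<Rightarrow> bit) \<Rightarrow> real" where
  "probZ \<delta> m Z = (\<Prod>x\<in>points m. if Z x = 1 then \<delta> else 1 - \<delta>)"

definition cond_entropy :: "('w \<Rightarrow> real) \<Rightarrow> 'w set \<Rightarrow> ('w \<Rightarrow> 'a) \<Rightarrow> ('w \<Rightarrow> 'b) \<Rightarrow> real" where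
  "cond_entropy p \<Omega> X Y =
     - (\<Sum>(u, v)\<in>(\<lambda>\<omega>. (X \<omega>, Y \<omega>)) ` \<Omega>.
          let pxy = (\<Sum>\<omega>\<in>{\<omega>\<in>\<Omega>. X \<omega> = u \<and> Y \<omega> = v}. p \<omega>);
              py  = (\<Sum>\<omega>\<in>{\<omega>\<in>\<Omega>. Y \<omega> = v}. p \<omega>)
          in pxy * log 2 (pxy / py))"

definition W_low :: "nat \<Rightarrow> nat \<Rightarrow> ((nat \<Rightarrow> bit) \<Rightarrow> bit) \<Rightarrow> (nat set \<Rightarrow> bit)" where
  "W_low m r Z = restrict (ml_coeffs m Z) {S\<in>Pow {..<m}. card S \<le> r}"

definition W_high :: "nat \<Rightarrow> nat \<Rightarrow> ((nat \<Rightarrow> bit) \<Rightarrow> bit) \<Rightarrow> (nat set \<Rightarrow> bit)" where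
  "W_high m r Z = restrict (ml_coeffs m Z) {S\<in>Pow {..<m}. card S > r}"

definition a_entropy :: "real \<Rightarrow> nat \<Rightarrow> nat \<Rightarrow> real" where
  "a_entropy \<delta> m r = cond_entropy (probZ \<delta> m) (configs m) (W_low m r) (W_high m r)"

end

theory Submission
  imports Defs "HOL-Real_Asymp.Real_Asymp"
begin

text \<open>
  The quantity \<open>a_entropy \<delta> m r\<close> is the entropy of the noise \<open>Z\<close> given its coset modulo the Reed--Muller
  code of degree \<open>r\<close>, so it suffices to find each \<open>Z\<^sub>x\<close> from the coset with error probability
  \<open>2^(-c sqrt m)\<close>; by translation invariance only \<open>x = 0\<close> matters. For a code of rate below capacity the
  channel output is far from uniform, and tensorization of entropy together with transitivity gives, at
  every position, an estimator of the codeword symbol from the other outputs whose mean bias is bounded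
  below. To boost it, restrict to a random \<open>(m - k)\<close>-dimensional subspace, on which the code restricts to
  a Reed--Muller code of the same degree, and average the estimators at \<open>0\<close> over all subspaces of the
  family. Every nonzero point lies in a fraction at most \<open>2^-k\<close> of them, so the average has variance at
  most \<open>2^-k\<close> and Chebyshev's inequality applies. With \<open>k\<close> about \<open>\<epsilon> sqrt m\<close> the restricted code is still
  below capacity, because a binomial distribution on \<open>n\<close> trials has no atom larger than \<open>1 / sqrt n\<close>.
\<close>

section \<open>Bernoulli product measures\<close>

text \<open>The deleted rules rewrite sums and products of bits as bitwise operations, which hides
  the ring structure that the polynomial arguments use.\<close>

declare add_bit_eq_xor [simp del] mult_bit_eq_and [simp del]

text \<open>Expectation under independent Bernoulli(\<open>\<delta>\<close>) coordinates. The
  explicit sum over extensional functions permits induction on \<open>I\<close>, peeling off one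
  coordinate at a time.\<close>

definition bexp :: "real \<Rightarrow> 'a set \<Rightarrow> (('a \<Rightarrow> bit) \<Rightarrow> real) \<Rightarrow> real" where
  "bexp \<delta> I F = (\<Sum>z\<in>I \<rightarrow>\<^sub>E UNIV. (\<Prod>i\<in>I. if z i = 1 then \<delta> else 1 - \<delta>) * F z)"

lemma UNIV_bit: "UNIV = {0, 1::bit}"
  by (auto intro: bit.exhaust)

lemma finite_UNIV_bit [simp]: "finite (UNIV :: bit set)"
  by (simp add: UNIV_bit)

lemma card_UNIV_bit [simp]: "card (UNIV :: bit set) = 2"
  by (simp add: UNIV_bit numeral_2_eq_2)

lemma sum_PiE_insert:
  fixes F :: "('a \<Rightarrow> bit) \<Rightarrow> 'b::comm_monoid_add"
  assumes "i \<notin> I"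
  shows "(\<Sum>z\<in>insert i I \<rightarrow>\<^sub>E UNIV. F z) = (\<Sum>z\<in>I \<rightarrow>\<^sub>E UNIV. F (z(i := 0)) + F (z(i := 1)))"
proof -
  have "(\<Sum>z\<in>insert i I \<rightarrow>\<^sub>E UNIV. F z) = (\<Sum>(b, z)\<in>UNIV \<times> (I \<rightarrow>\<^sub>E UNIV). F (z(i := b)))"
    unfolding PiE_insert_eq using inj_combinator[OF assms, of "\<lambda>_. UNIV"]
    by (subst sum.reindex) (simp_all add: case_prod_unfold)
  also have "\<dots> = (\<Sum>b\<in>UNIV. \<Sum>z\<in>I \<rightarrow>\<^sub>E UNIV. F (z(i := b)))"
    by (simp add: sum.cartesian_product)
  also have "\<dots> = (\<Sum>z\<in>I \<rightarrow>\<^sub>E UNIV. F (z(i := 0)) + F (z(i := 1)))"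
    by (simp add: UNIV_bit sum.distrib)
  finally show ?thesis .
qed

lemma bexp_insert:
  assumes "finite I" "i \<notin> I"
  shows "bexp \<delta> (insert i I) F = bexp \<delta> I (\<lambda>z. \<delta> * F (z(i := 1)) + (1 - \<delta>) * F (z(i := 0)))"
proof -
  have "(\<Prod>j\<in>I. if (z(i := b)) j = 1 then \<delta> else 1 - \<delta>) = (\<Prod>j\<in>I. if z j = 1 then \<delta> else 1 - \<delta>)"
    for z :: "'a \<Rightarrow> bit" and b
    using assms by (intro prod.cong) auto
  then have "(\<Prod>j\<in>insert i I. if (z(i := b)) j = 1 then \<delta> else 1 - \<delta>)
      = (if b = 1 then \<delta> else 1 - \<delta>) * (\<Prod>j\<in>I. if z j = 1 then \<delta> else 1 - \<delta>)"
    for z :: "'a \<Rightarrow> bit" and b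
    unfolding prod.insert[OF assms] by (simp only: fun_upd_same)
  then show ?thesis
    using assms unfolding bexp_def
    by (simp add: sum_PiE_insert algebra_simps sum.distrib del: fun_upd_apply prod.insert)
qed

lemma bexp_add: "bexp \<delta> I (\<lambda>z. F z + G z) = bexp \<delta> I F + bexp \<delta> I G"
  by (simp add: bexp_def algebra_simps sum.distrib)

lemma bexp_cmult: "bexp \<delta> I (\<lambda>z. c * F z) = c * bexp \<delta> I F"
  by (simp add: bexp_def sum_distrib_left mult_ac)

lemma bexp_sum: "bexp \<delta> I (\<lambda>z. \<Sum>b\<in>B. F b z) = (\<Sum>b\<in>B. bexp \<delta> I (F b))"
  by (simp add: bexp_def sum_distrib_left) (rule sum.swap)

lemma bexp_const: "finite I \<Longrightarrow> bexp \<delta> I (\<lambda>_. c) = c"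
proof (induction I rule: finite_induct)
  case (insert i I)
  have "\<delta> * c + (1 - \<delta>) * c = c" by (simp add: algebra_simps)
  then show ?case using insert by (simp add: bexp_insert)
qed (simp add: bexp_def)

lemma bexp_cong:
  "(\<And>z. z \<in> I \<rightarrow>\<^sub>E UNIV \<Longrightarrow> F z = G z) \<Longrightarrow> bexp \<delta> I F = bexp \<delta> I G"
  by (simp add: bexp_def)

lemma bexp_mono:
  assumes "0 \<le> \<delta>" "\<delta> \<le> 1" "\<And>z. z \<in> I \<rightarrow>\<^sub>E UNIV \<Longrightarrow> F z \<le> G z"
  shows "bexp \<delta> I F \<le> bexp \<delta> I G"
  unfolding bexp_def using assms by (intro sum_mono mult_left_mono prod_nonneg) auto

text \<open>Distinct coordinates of i.i.d. noise, read through an injection, are again i.i.d. noise.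
  This transports means along graph maps and translations.\<close>

lemma bexp_pullback:
  assumes "finite J" "finite I" "inj_on A J" "A ` J \<subseteq> I"
  shows "bexp \<delta> I (\<lambda>z. F (restrict (z \<circ> A) J)) = bexp \<delta> J F"
  using assms
proof (induction J arbitrary: I F rule: finite_induct)
  case empty
  then show ?case by (simp add: bexp_const restrict_def) (simp add: bexp_def)
next
  case (insert j J)
  define K where "K = I - {A j}"
  have I: "I = insert (A j) K" "A j \<notin> K" "finite K" and AK: "A ` J \<subseteq> K" and inj: "inj_on A J"
    using insert.prems insert.hyps by (auto simp: K_def inj_on_def)
  have *: "restrict (z(A j := b) \<circ> A) (insert j J) = (restrict (z \<circ> A) J)(j := b)" for z b
  proof
    fix a
    show "restrict (z(A j := b) \<circ> A) (insert j J) a = ((restrict (z \<circ> A) J)(j := b)) a"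
      using AK I(2) insert.hyps by (cases "a = j"; cases "a \<in> J") auto
  qed
  have "bexp \<delta> (insert (A j) K) (\<lambda>z. F (restrict (z \<circ> A) (insert j J)))
      = bexp \<delta> K (\<lambda>z. \<delta> * F ((restrict (z \<circ> A) J)(j := 1)) + (1 - \<delta>) * F ((restrict (z \<circ> A) J)(j := 0)))"
    unfolding bexp_insert[OF I(3,2)] * ..
  also have "\<dots> = bexp \<delta> J (\<lambda>z. \<delta> * F (z(j := 1)) + (1 - \<delta>) * F (z(j := 0)))"
    by (rule insert.IH[OF I(3) inj AK])
  finally show ?case unfolding I(1) bexp_insert[OF insert.hyps(1,2)] .
qed

section \<open>Variance of sums of functions of few coordinates\<close>

definition bvar :: "real \<Rightarrow> 'a set \<Rightarrow> (('a \<Rightarrow> bit) \<Rightarrow> real) \<Rightarrow> real" where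
  "bvar \<delta> I F = bexp \<delta> I (\<lambda>z. (F z)\<^sup>2) - (bexp \<delta> I F)\<^sup>2"

text \<open>Law of total variance for coordinate \<open>i\<close>: the variance of the conditional
  mean plus the mean of a two-point variance.\<close>

lemma bvar_insert:
  assumes "finite I" "i \<notin> I"
  shows "bvar \<delta> (insert i I) F = bvar \<delta> I (\<lambda>z. \<delta> * F (z(i := 1)) + (1 - \<delta>) * F (z(i := 0)))
     + \<delta> * (1 - \<delta>) * bexp \<delta> I (\<lambda>z. (F (z(i := 1)) - F (z(i := 0)))\<^sup>2)"
proof -
  have "\<delta> * (F (z(i := 1)))\<^sup>2 + (1 - \<delta>) * (F (z(i := 0)))\<^sup>2
     = (\<delta> * F (z(i := 1)) + (1 - \<delta>) * F (z(i := 0)))\<^sup>2 + \<delta> * (1 - \<delta>) * (F (z(i := 1)) - F (z(i := 0)))\<^sup>2" for z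
    by (simp add: power2_eq_square algebra_simps)
  then show ?thesis
    using assms by (simp add: bvar_def bexp_insert bexp_add bexp_cmult)
qed

text \<open>
  The contribution of a coordinate to the variance of the sum only involves the functions depending
  on it, so Cauchy--Schwarz costs a factor \<open>N\<close> instead of the number of functions.
\<close>
lemma bvar_sum_le:
  fixes \<phi> :: "'b \<Rightarrow> ('a \<Rightarrow> bit) \<Rightarrow> real"
  assumes "finite I" "finite \<B>" "0 \<le> \<delta>" "\<delta> \<le> 1"
    and "\<And>b z i v. b \<in> \<B> \<Longrightarrow> i \<in> I - D b \<Longrightarrow> z \<in> I \<rightarrow>\<^sub>E UNIV \<Longrightarrow> \<phi> b (z(i := v)) = \<phi> b z"
    and "\<And>i. i \<in> I \<Longrightarrow> real (card {b \<in> \<B>. i \<in> D b}) \<le> N"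
  shows "bvar \<delta> I (\<lambda>z. \<Sum>b\<in>\<B>. \<phi> b z) \<le> N * (\<Sum>b\<in>\<B>. bvar \<delta> I (\<phi> b))"
  using assms
proof (induction I arbitrary: \<phi> rule: finite_induct)
  case empty
  then show ?case by (simp add: bvar_def bexp_def)
next
  case (insert i I)
  define \<psi> where "\<psi> b z = \<delta> * \<phi> b (z(i := 1)) + (1 - \<delta>) * \<phi> b (z(i := 0))" for b z
  define d where "d b z = \<phi> b (z(i := 1)) - \<phi> b (z(i := 0))" for b z
  have ins: "z(i := v) \<in> insert i I \<rightarrow>\<^sub>E UNIV" if "z \<in> I \<rightarrow>\<^sub>E UNIV" for z :: "'a \<Rightarrow> bit" and v
    using that by (auto simp: PiE_iff extensional_def)
  have 1: "bvar \<delta> I (\<lambda>z. \<Sum>b\<in>\<B>. \<psi> b z) \<le> N * (\<Sum>b\<in>\<B>. bvar \<delta> I (\<psi> b))"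
  proof (rule insert.IH)
    fix b z j v assume *: "b \<in> \<B>" "j \<in> I - D b" "z \<in> I \<rightarrow>\<^sub>E (UNIV::bit set)"
    have ne: "i \<noteq> j" using * insert.hyps by auto
    have "\<phi> b ((z(j := v))(i := w)) = \<phi> b (z(i := w))" for w
      using insert.prems(4)[OF *(1), of j "z(i := w)" v] * ins[OF *(3), of w] by (simp add: fun_upd_twist[OF ne] del: fun_upd_apply)
    then show "\<psi> b (z(j := v)) = \<psi> b z" by (simp add: \<psi>_def)
  qed (use insert in auto)
  have 2: "(\<Sum>b\<in>\<B>. d b z)\<^sup>2 \<le> N * (\<Sum>b\<in>\<B>. (d b z)\<^sup>2)" if z: "z \<in> I \<rightarrow>\<^sub>E UNIV" for z
  proof -
    define B where "B = {b \<in> \<B>. i \<in> D b}"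
    have 0: "d b z = 0" if "b \<in> \<B> - B" for b
    proof -
      have "\<phi> b ((z(i := 0))(i := 1)) = \<phi> b (z(i := 0))"
        using that ins[OF z, of 0] by (intro insert.prems(4)) (auto simp: B_def simp del: fun_upd_apply)
      then show ?thesis by (simp add: d_def)
    qed
    have "(\<Sum>b\<in>\<B>. d b z) = (\<Sum>b\<in>B. d b z)"
      using insert.prems(1) 0 by (intro sum.mono_neutral_right) (auto simp: B_def)
    then have "(\<Sum>b\<in>\<B>. d b z)\<^sup>2 \<le> (\<Sum>b\<in>B. (d b z)\<^sup>2) * (\<Sum>b\<in>B. 1\<^sup>2)"
      using Cauchy_Schwarz_ineq_sum[of "\<lambda>b. d b z" "\<lambda>_. 1" B] by simp
    also have "\<dots> = real (card B) * (\<Sum>b\<in>B. (d b z)\<^sup>2)" by simp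
    also have "\<dots> \<le> N * (\<Sum>b\<in>\<B>. (d b z)\<^sup>2)"
      using insert.prems(1) insert.prems(5)[of i]
      by (intro mult_mono sum_mono2 sum_nonneg) (auto simp: B_def)
    finally show ?thesis .
  qed
  have "bvar \<delta> (insert i I) (\<lambda>z. \<Sum>b\<in>\<B>. \<phi> b z)
      = bvar \<delta> I (\<lambda>z. \<Sum>b\<in>\<B>. \<psi> b z) + \<delta> * (1 - \<delta>) * bexp \<delta> I (\<lambda>z. (\<Sum>b\<in>\<B>. d b z)\<^sup>2)"
    using insert.hyps
    by (simp add: bvar_insert \<psi>_def d_def sum_distrib_left sum.distrib sum_subtractf)
  also have "\<dots> \<le> N * (\<Sum>b\<in>\<B>. bvar \<delta> I (\<psi> b)) + \<delta> * (1 - \<delta>) * bexp \<delta> I (\<lambda>z. N * (\<Sum>b\<in>\<B>. (d b z)\<^sup>2))"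
    using insert.prems(2,3) by (intro add_mono 1 mult_left_mono bexp_mono 2) auto
  also have "\<dots> = N * (\<Sum>b\<in>\<B>. bvar \<delta> (insert i I) (\<phi> b))"
  proof -
    have "bvar \<delta> (insert i I) (\<phi> b) = bvar \<delta> I (\<psi> b) + \<delta> * (1 - \<delta>) * bexp \<delta> I (\<lambda>z. (d b z)\<^sup>2)" for b
      using insert.hyps by (simp add: bvar_insert \<psi>_def[abs_def] d_def)
    then show ?thesis
      by (simp add: bexp_cmult bexp_sum sum.distrib sum_distrib_left[symmetric] distrib_left mult_ac)
  qed
  finally show ?case .
qed

section \<open>Tensorization of entropy on the cube\<close>

text \<open>The quotient \<open>(a - b)^2 / (a + b)\<close> is convex and homogeneous. By completing
  the square it dominates the linear form \<open>2 * t * (a - b) - t^2 * (a + b)\<close> for every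
  \<open>t\<close>; the chosen \<open>t\<close> gives equality at the totals.\<close>

lemma sum_sq_div_le:
  fixes a b :: "'a \<Rightarrow> real"
  assumes "finite S" "S \<noteq> {}" "\<And>x. x \<in> S \<Longrightarrow> a x > 0" "\<And>x. x \<in> S \<Longrightarrow> b x > 0"
  shows "(sum a S - sum b S)\<^sup>2 / (sum a S + sum b S) \<le> (\<Sum>x\<in>S. (a x - b x)\<^sup>2 / (a x + b x))"
proof -
  define t where "t = (sum a S - sum b S) / (sum a S + sum b S)"
  have pos: "sum a S + sum b S > 0" using assms by (intro add_pos_pos sum_pos) auto
  have "(sum a S - sum b S)\<^sup>2 / (sum a S + sum b S)
      = 2 * t * (sum a S - sum b S) - t\<^sup>2 * (sum a S + sum b S)"
    using pos unfolding t_def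
    by (simp add: power_divide) (simp add: power2_eq_square)
  also have "\<dots> = (\<Sum>x\<in>S. 2 * t * (a x - b x) - t\<^sup>2 * (a x + b x))"
    by (simp add: sum_subtractf sum_distrib_left[symmetric] sum.distrib)
  also have "\<dots> \<le> (\<Sum>x\<in>S. (a x - b x)\<^sup>2 / (a x + b x))"
  proof (rule sum_mono)
    fix x assume "x \<in> S"
    then have p: "a x + b x > 0" using assms by (simp add: add_pos_pos)
    have "0 \<le> ((a x - b x) - t * (a x + b x))\<^sup>2 / (a x + b x)" using p by simp
    also have "\<dots> = (a x - b x)\<^sup>2 / (a x + b x) - (2 * t * (a x - b x) - t\<^sup>2 * (a x + b x))"
      using p by (simp add: power2_eq_square field_simps)
    finally show "2 * t * (a x - b x) - t\<^sup>2 * (a x + b x) \<le> (a x - b x)\<^sup>2 / (a x + b x)" by simp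
  qed
  finally show ?thesis .
qed

text \<open>Relative entropy to the uniform law is bounded by a chi-square term, through
  \<open>ln x \<le> x - 1\<close>.\<close>

lemma two_point_entropy_le:
  fixes a b :: real
  assumes "a > 0" "b > 0"
  shows "a * ln (2 * a / (a + b)) + b * ln (2 * b / (a + b)) \<le> (a - b)\<^sup>2 / (a + b)"
proof -
  have "a * ln (2 * a / (a + b)) \<le> a * (2 * a / (a + b) - 1)"
    "b * ln (2 * b / (a + b)) \<le> b * (2 * b / (a + b) - 1)"
    using assms by (auto intro!: mult_left_mono ln_le_minus_one)
  moreover have "a * (2 * a / (a + b) - 1) + b * (2 * b / (a + b) - 1) = (a - b)\<^sup>2 / (a + b)"
  proof -
    have "2 * a / (a + b) - 1 = (a - b) / (a + b)" "2 * b / (a + b) - 1 = - ((a - b) / (a + b))"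
      using assms by (auto simp: field_simps)
    moreover have "a * t + b * - t = (a - b) * t" for t :: real by (simp add: algebra_simps)
    ultimately have "a * (2 * a / (a + b) - 1) + b * (2 * b / (a + b) - 1) = (a - b) * ((a - b) / (a + b))"
      by metis
    then show ?thesis by (simp add: power2_eq_square)
  qed
  ultimately show ?thesis by linarith
qed

text \<open>
  The logarithmic terms on the right-hand side of the usual tensorization inequality are already
  replaced by their quadratic upper bounds, so that the induction step needs only Cauchy--Schwarz.
\<close>
lemma entropy_tensorization:
  fixes f :: "('a \<Rightarrow> bit) \<Rightarrow> real"
  assumes "finite I" "\<And>y. y \<in> I \<rightarrow>\<^sub>E UNIV \<Longrightarrow> f y > 0"
  shows "(\<Sum>y\<in>I \<rightarrow>\<^sub>E UNIV. f y * ln (2 ^ card I * f y / (\<Sum>y\<in>I \<rightarrow>\<^sub>E UNIV. f y)))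
     \<le> (\<Sum>i\<in>I. \<Sum>y\<in>(I - {i}) \<rightarrow>\<^sub>E UNIV. (f (y(i := 0)) - f (y(i := 1)))\<^sup>2 / (f (y(i := 0)) + f (y(i := 1))))"
  using assms
proof (induction I arbitrary: f rule: finite_induct)
  case empty
  then show ?case by simp
next
  case (insert j J)
  define Q where "Q i f y = (f (y(i := 0)) - f (y(i := 1)))\<^sup>2 / (f (y(i := 0)) + f (y(i := 1)))"
    for i and f :: "('a \<Rightarrow> bit) \<Rightarrow> real" and y
  define g where "g v y = f (y(j := v))" for v y
  define S where "S v = (\<Sum>y\<in>J \<rightarrow>\<^sub>E UNIV. g v y)" for v
  have ins: "z(j := v) \<in> insert j J \<rightarrow>\<^sub>E UNIV" if "z \<in> J \<rightarrow>\<^sub>E UNIV" for z :: "'a \<Rightarrow> bit" and v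
    using that by (auto simp: PiE_iff extensional_def)
  have gpos: "g v y > 0" if "y \<in> J \<rightarrow>\<^sub>E UNIV" for v y
    unfolding g_def using insert.prems[OF ins[OF that]] .
  have fin: "finite (J \<rightarrow>\<^sub>E (UNIV::bit set))" using insert.hyps by (intro finite_PiE) auto
  have ne: "J \<rightarrow>\<^sub>E (UNIV::bit set) \<noteq> {}" by (simp add: PiE_eq_empty_iff)
  have Spos: "S v > 0" for v unfolding S_def using fin ne gpos by (intro sum_pos) auto
  have tot: "(\<Sum>y\<in>insert j J \<rightarrow>\<^sub>E UNIV. f y) = S 0 + S 1"
    using insert.hyps by (simp add: sum_PiE_insert S_def g_def sum.distrib)
  have IH: "(\<Sum>y\<in>J \<rightarrow>\<^sub>E UNIV. g v y * ln (2 ^ card J * g v y / S v))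
      \<le> (\<Sum>i\<in>J. \<Sum>y\<in>(J - {i}) \<rightarrow>\<^sub>E UNIV. Q i (g v) y)" for v
    unfolding S_def Q_def using gpos by (intro insert.IH)
  \<comment> \<open>Chain rule: the entropy inside the slice \<open>j = v\<close>, normalised by its
    own mass, plus the contribution of that mass.\<close>
  have split: "(\<Sum>y\<in>J \<rightarrow>\<^sub>E UNIV. g v y * ln (2 ^ card (insert j J) * g v y / (S 0 + S 1)))
      = (\<Sum>y\<in>J \<rightarrow>\<^sub>E UNIV. g v y * ln (2 ^ card J * g v y / S v)) + S v * ln (2 * S v / (S 0 + S 1))" for v
  proof -
    have "ln (2 ^ card (insert j J) * g v y / (S 0 + S 1))
        = ln (2 ^ card J * g v y / S v) + ln (2 * S v / (S 0 + S 1))" if "y \<in> J \<rightarrow>\<^sub>E UNIV" for y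
    proof -
      have "2 ^ card (insert j J) * g v y / (S 0 + S 1) = (2 ^ card J * g v y / S v) * (2 * S v / (S 0 + S 1))"
        using Spos[of v] insert.hyps by simp
      moreover have "2 ^ card J * g v y / S v > 0" "2 * S v / (S 0 + S 1) > 0"
        using gpos[OF that, of v] Spos[of v] Spos[of 0] Spos[of 1] by simp_all
      ultimately show ?thesis by (simp only: ln_mult_pos)
    qed
    then have "(\<Sum>y\<in>J \<rightarrow>\<^sub>E UNIV. g v y * ln (2 ^ card (insert j J) * g v y / (S 0 + S 1)))
        = (\<Sum>y\<in>J \<rightarrow>\<^sub>E UNIV. g v y * ln (2 ^ card J * g v y / S v) + g v y * ln (2 * S v / (S 0 + S 1)))"
      by (intro sum.cong) (simp_all only: distrib_left)
    then show ?thesis by (simp only: sum.distrib sum_distrib_right[symmetric] S_def)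
  qed
  have "(\<Sum>y\<in>insert j J \<rightarrow>\<^sub>E UNIV. f y * ln (2 ^ card (insert j J) * f y / (\<Sum>y\<in>insert j J \<rightarrow>\<^sub>E UNIV. f y)))
     = (\<Sum>y\<in>J \<rightarrow>\<^sub>E UNIV. g 0 y * ln (2 ^ card (insert j J) * g 0 y / (S 0 + S 1)))
       + (\<Sum>y\<in>J \<rightarrow>\<^sub>E UNIV. g 1 y * ln (2 ^ card (insert j J) * g 1 y / (S 0 + S 1)))"
    unfolding tot using insert.hyps by (simp add: sum_PiE_insert g_def sum.distrib)
  also have "\<dots> \<le> (\<Sum>i\<in>J. \<Sum>y\<in>(J - {i}) \<rightarrow>\<^sub>E UNIV. Q i (g 0) y) + (\<Sum>i\<in>J. \<Sum>y\<in>(J - {i}) \<rightarrow>\<^sub>E UNIV. Q i (g 1) y)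
       + (S 0 - S 1)\<^sup>2 / (S 0 + S 1)"
    using IH[of 0] IH[of 1] two_point_entropy_le[OF Spos Spos, of 0 1] unfolding split by linarith
  \<comment> \<open>The slice masses are sums over fibres in direction \<open>j\<close>, so
    convexity moves the marginal term into the individual fibres.\<close>
  also have "(S 0 - S 1)\<^sup>2 / (S 0 + S 1) \<le> (\<Sum>y\<in>J \<rightarrow>\<^sub>E UNIV. Q j f y)"
    unfolding S_def Q_def g_def[symmetric] using fin ne gpos by (intro sum_sq_div_le) auto
  \<comment> \<open>For \<open>i \<noteq> j\<close>, the edges in direction \<open>i\<close> of the
    two slices together are all edges in that direction.\<close>
  also have "(\<Sum>i\<in>J. \<Sum>y\<in>(J - {i}) \<rightarrow>\<^sub>E UNIV. Q i (g 0) y) + (\<Sum>i\<in>J. \<Sum>y\<in>(J - {i}) \<rightarrow>\<^sub>E UNIV. Q i (g 1) y)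
      = (\<Sum>i\<in>J. \<Sum>y\<in>(insert j J - {i}) \<rightarrow>\<^sub>E UNIV. Q i f y)"
  proof (subst sum.distrib[symmetric], rule sum.cong[OF refl])
    fix i assume i: "i \<in> J"
    then have ij: "i \<noteq> j" using insert.hyps by auto
    then have "insert j J - {i} = insert j (J - {i})" by auto
    then show "(\<Sum>y\<in>(J - {i}) \<rightarrow>\<^sub>E UNIV. Q i (g 0) y) + (\<Sum>y\<in>(J - {i}) \<rightarrow>\<^sub>E UNIV. Q i (g 1) y)
        = (\<Sum>y\<in>(insert j J - {i}) \<rightarrow>\<^sub>E UNIV. Q i f y)"
      using insert.hyps by (simp add: sum_PiE_insert Q_def g_def sum.distrib fun_upd_twist[OF ij])
  qed
  also have "(\<Sum>i\<in>J. \<Sum>y\<in>(insert j J - {i}) \<rightarrow>\<^sub>E UNIV. Q i f y) + (\<Sum>y\<in>J \<rightarrow>\<^sub>E UNIV. Q j f y)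
      = (\<Sum>i\<in>insert j J. \<Sum>y\<in>(insert j J - {i}) \<rightarrow>\<^sub>E UNIV. Q i f y)"
    using insert.hyps by (simp add: add.commute)
  finally show ?case by (simp only: Q_def)
qed

section \<open>Linear codes with Bernoulli noise\<close>

definition cadd :: "'a set \<Rightarrow> ('a \<Rightarrow> bit) \<Rightarrow> ('a \<Rightarrow> bit) \<Rightarrow> 'a \<Rightarrow> bit" where
  "cadd I y x = restrict (\<lambda>i. y i + x i) I"

text \<open>Since every word is its own negative, nonempty and closed under addition already means a
  subspace.\<close>

definition linear_code :: "'a set \<Rightarrow> ('a \<Rightarrow> bit) set \<Rightarrow> bool" where
  "linear_code I C \<longleftrightarrow> C \<subseteq> I \<rightarrow>\<^sub>E UNIV \<and> C \<noteq> {} \<and> (\<forall>x\<in>C. \<forall>y\<in>C. cadd I x y \<in> C)"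

definition bsgn :: "bit \<Rightarrow> real" where
  "bsgn b = (if b = 0 then 1 else -1)"

definition bprob :: "real \<Rightarrow> 'a set \<Rightarrow> ('a \<Rightarrow> bit) \<Rightarrow> real" where
  "bprob \<delta> I z = (\<Prod>i\<in>I. if z i = 1 then \<delta> else 1 - \<delta>)"

text \<open>
  If \<open>X\<close> is uniform on \<open>C\<close> and \<open>Y = X + Z\<close>, then \<open>output_weight \<delta> I C y = card C * P(Y = y)\<close>,
  and \<open>soft_dec \<delta> I C i y\<close> is the bias \<open>E((-1)^Y\<^sub>i)\<close> conditional on \<open>Y\<close> agreeing with \<open>y\<close> off \<open>i\<close>.
\<close>
definition output_weight :: "real \<Rightarrow> 'a set \<Rightarrow> ('a \<Rightarrow> bit) set \<Rightarrow> ('a \<Rightarrow> bit) \<Rightarrow> real" where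
  "output_weight \<delta> I C y = (\<Sum>x\<in>C. bprob \<delta> I (cadd I y x))"

definition soft_dec :: "real \<Rightarrow> 'a set \<Rightarrow> ('a \<Rightarrow> bit) set \<Rightarrow> 'a \<Rightarrow> ('a \<Rightarrow> bit) \<Rightarrow> real" where
  "soft_dec \<delta> I C i y =
     (output_weight \<delta> I C (y(i := 0)) - output_weight \<delta> I C (y(i := 1))) /
     (output_weight \<delta> I C (y(i := 0)) + output_weight \<delta> I C (y(i := 1)))"

lemma bit_add_self [simp]: "(b::bit) + b = 0"
  by (cases b) auto

lemma cadd_in_PiE [simp]: "cadd I y x \<in> I \<rightarrow>\<^sub>E UNIV"
  by (simp add: cadd_def)

lemma cadd_assoc: "cadd I (cadd I y x) z = cadd I y (cadd I x z)"
  by (auto simp: cadd_def fun_eq_iff add.assoc)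

lemma cadd_commute: "cadd I y x = cadd I x y"
  by (auto simp: cadd_def fun_eq_iff add.commute)

lemma cadd_cancel: "y \<in> I \<rightarrow>\<^sub>E UNIV \<Longrightarrow> cadd I (cadd I y x) x = y"
  by (auto simp: cadd_def fun_eq_iff add.assoc PiE_iff extensional_def)

lemma sum_cadd:
  "(\<Sum>y\<in>I \<rightarrow>\<^sub>E UNIV. F (cadd I y x)) = (\<Sum>y\<in>I \<rightarrow>\<^sub>E UNIV. F y)"
  by (rule sum.reindex_bij_witness[of _ "\<lambda>y. cadd I y x" "\<lambda>y. cadd I y x"]) (simp_all add: cadd_cancel)

lemma bsgn_add: "bsgn (a + b) = bsgn a * bsgn b"
  by (cases a; cases b) (auto simp: bsgn_def)

lemma bexp_eq: "bexp \<delta> I F = (\<Sum>z\<in>I \<rightarrow>\<^sub>E UNIV. bprob \<delta> I z * F z)"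
  by (simp add: bexp_def bprob_def)

lemma bprob_pos: "0 < \<delta> \<Longrightarrow> \<delta> < 1 \<Longrightarrow> bprob \<delta> I z > 0"
  by (auto simp: bprob_def intro!: prod_pos)

lemma sum_bprob: "finite I \<Longrightarrow> (\<Sum>z\<in>I \<rightarrow>\<^sub>E UNIV. bprob \<delta> I z) = 1"
  using bexp_const[of I \<delta> 1] by (simp add: bexp_eq)

lemma bexp_coord:
  assumes "finite I" "i \<in> I"
  shows "bexp \<delta> I (\<lambda>z. g (z i)) = \<delta> * g 1 + (1 - \<delta>) * g 0"
proof -
  have "bexp \<delta> (insert i (I - {i})) (\<lambda>z. g (z i)) = \<delta> * g 1 + (1 - \<delta>) * g 0"
    using assms by (subst bexp_insert) (simp_all add: bexp_const)
  then show ?thesis using assms by (simp add: insert_absorb)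
qed

text \<open>Minus the entropy of the noise, in nats; it adds up over the independent
  coordinates.\<close>

lemma bexp_ln_bprob:
  assumes "finite I" "0 < \<delta>" "\<delta> < 1"
  shows "bexp \<delta> I (\<lambda>z. ln (bprob \<delta> I z)) = - real (card I) * ln 2 * bin_entropy \<delta>"
proof -
  have "ln (bprob \<delta> I z) = (\<Sum>i\<in>I. if z i = 1 then ln \<delta> else ln (1 - \<delta>))" for z
    unfolding bprob_def using assms by (subst ln_prod) (auto intro!: sum.cong)
  then have "bexp \<delta> I (\<lambda>z. ln (bprob \<delta> I z))
      = (\<Sum>i\<in>I. bexp \<delta> I (\<lambda>z. if z i = 1 then ln \<delta> else ln (1 - \<delta>)))"
    by (simp add: bexp_sum)
  also have "\<dots> = (\<Sum>i\<in>I. \<delta> * ln \<delta> + (1 - \<delta>) * ln (1 - \<delta>))"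
    using assms bexp_coord[of I _ \<delta> "\<lambda>b. if b = 1 then ln \<delta> else ln (1 - \<delta>)"] by (intro sum.cong) auto
  also have "\<dots> = - real (card I) * ln 2 * bin_entropy \<delta>"
    by (simp add: bin_entropy_def log_def field_simps)
  finally show ?thesis .
qed

context
  fixes \<delta> :: real and I :: "'a set" and C
  assumes fin: "finite I" and \<delta>: "0 < \<delta>" "\<delta> < 1" and lin: "linear_code I C"
begin

lemma finite_code: "finite C"
proof (rule finite_subset)
  show "C \<subseteq> I \<rightarrow>\<^sub>E UNIV" using lin by (simp add: linear_code_def)
  show "finite (I \<rightarrow>\<^sub>E (UNIV::bit set))" using fin by (intro finite_PiE) auto
qed

lemma code_card_pos: "card C > 0"
  using lin finite_code by (auto simp: linear_code_def card_gt_0_iff)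

lemma output_weight_pos: "output_weight \<delta> I C y > 0"
  unfolding output_weight_def using lin finite_code \<delta>
  by (intro sum_pos bprob_pos) (auto simp: linear_code_def)

lemma output_weight_cadd:
  assumes "x \<in> C"
  shows "output_weight \<delta> I C (cadd I y x) = output_weight \<delta> I C y"
  unfolding output_weight_def cadd_assoc
proof (rule sum.reindex_bij_witness[of _ "\<lambda>z. cadd I x z" "\<lambda>z. cadd I x z"])
  fix z assume z: "z \<in> C"
  show xz: "cadd I x z \<in> C" using z assms lin by (auto simp: linear_code_def)
  have "z \<in> I \<rightarrow>\<^sub>E UNIV" using z lin by (auto simp: linear_code_def)
  then show cancel: "cadd I x (cadd I x z) = z"
    using cadd_cancel[of z I x] by (simp add: cadd_commute)
  show "cadd I x z \<in> C" "cadd I x (cadd I x z) = z" by fact+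
qed simp

lemma sum_output_weight: "(\<Sum>y\<in>I \<rightarrow>\<^sub>E UNIV. output_weight \<delta> I C y) = real (card C)"
proof -
  have "(\<Sum>y\<in>I \<rightarrow>\<^sub>E UNIV. output_weight \<delta> I C y) = (\<Sum>x\<in>C. \<Sum>y\<in>I \<rightarrow>\<^sub>E UNIV. bprob \<delta> I (cadd I y x))"
    unfolding output_weight_def by (rule sum.swap)
  then show ?thesis by (simp add: sum_cadd sum_bprob fin)
qed

text \<open>Adding a codeword preserves output weights, and exchanges the two candidates at position
  \<open>i\<close> exactly when \<open>x i = 1\<close>. This equivariance lets the sign serve as a
  decoder.\<close>

lemma soft_dec_cadd:
  assumes "x \<in> C" "i \<in> I"
  shows "soft_dec \<delta> I C i (cadd I y x) = bsgn (x i) * soft_dec \<delta> I C i y"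
proof -
  have *: "(cadd I y x)(i := b) = cadd I (y(i := b + x i)) x" for b
    using assms(2) by (auto simp: cadd_def fun_eq_iff add.assoc)
  have "output_weight \<delta> I C ((cadd I y x)(i := b)) = output_weight \<delta> I C (y(i := b + x i))" for b
    unfolding * by (rule output_weight_cadd[OF assms(1)])
  then show ?thesis
    by (cases "x i") (simp_all add: soft_dec_def bsgn_def add.commute minus_divide_left del: fun_upd_apply)
qed

lemma abs_soft_dec_le: "\<bar>soft_dec \<delta> I C i y\<bar> \<le> 1"
proof -
  have "\<bar>(a - b) / (a + b)\<bar> \<le> 1" if "a > 0" "b > 0" for a b :: real
    using that by (simp add: abs_le_iff field_simps)
  then show ?thesis unfolding soft_dec_def using output_weight_pos by blast
qed

text \<open>With \<open>g\<close> the soft decision, the left side is \<open>card C\<close> times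
  the mean of \<open>bsgn (Y i) * g Y\<close>. Equivariance replaces \<open>Y = X + Z\<close> by
  \<open>Z\<close>, and \<open>Z i\<close> is independent of \<open>g Z\<close>.\<close>

lemma sum_soft_dec:
  assumes i: "i \<in> I"
  shows "(\<Sum>y\<in>(I - {i}) \<rightarrow>\<^sub>E UNIV.
       (output_weight \<delta> I C (y(i := 0)) - output_weight \<delta> I C (y(i := 1)))\<^sup>2 /
       (output_weight \<delta> I C (y(i := 0)) + output_weight \<delta> I C (y(i := 1))))
     = real (card C) * (1 - 2 * \<delta>) * bexp \<delta> I (soft_dec \<delta> I C i)" (is "?L = _")
proof -
  let ?f = "output_weight \<delta> I C" and ?g = "soft_dec \<delta> I C i"
  have I: "I = insert i (I - {i})" using i by auto
  have ub: "?g (y(i := b)) = ?g y" for y b by (simp add: soft_dec_def)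
  have "?L = (\<Sum>y\<in>(I - {i}) \<rightarrow>\<^sub>E UNIV. (?f (y(i := 0)) - ?f (y(i := 1))) * ?g y)"
    by (simp add: soft_dec_def power2_eq_square)
  also have "\<dots> = (\<Sum>y\<in>insert i (I - {i}) \<rightarrow>\<^sub>E UNIV. ?f y * (bsgn (y i) * ?g y))"
    by (subst sum_PiE_insert) (simp_all only: ub, simp_all add: bsgn_def algebra_simps)
  also have "\<dots> = (\<Sum>y\<in>I \<rightarrow>\<^sub>E UNIV. ?f y * (bsgn (y i) * ?g y))"
    using I by simp
  also have "\<dots> = (\<Sum>x\<in>C. \<Sum>y\<in>I \<rightarrow>\<^sub>E UNIV. bprob \<delta> I (cadd I y x) * (bsgn (y i) * ?g y))"
    unfolding output_weight_def sum_distrib_right by (rule sum.swap)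
  also have "\<dots> = (\<Sum>x\<in>C. bexp \<delta> I (\<lambda>z. bsgn (z i) * ?g z))"
  proof (rule sum.cong[OF refl])
    fix x assume x: "x \<in> C"
    have "bsgn (cadd I z x i) * ?g (cadd I z x) = bsgn (z i) * ?g z" for z
    proof -
      have "bsgn (x i) * bsgn (x i) = 1" by (simp add: bsgn_def)
      moreover have "bsgn (cadd I z x i) = bsgn (z i) * bsgn (x i)"
        using i by (simp only: cadd_def restrict_apply' bsgn_add)
      ultimately show ?thesis by (simp add: soft_dec_cadd[OF x i])
    qed
    then have "(\<Sum>y\<in>I \<rightarrow>\<^sub>E UNIV. bprob \<delta> I (cadd I y x) * (bsgn (y i) * ?g y))
        = (\<Sum>y\<in>I \<rightarrow>\<^sub>E UNIV. bprob \<delta> I (cadd I y x) * (bsgn (cadd I y x i) * ?g (cadd I y x)))"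
      by simp
    also have "\<dots> = bexp \<delta> I (\<lambda>z. bsgn (z i) * ?g z)"
      unfolding bexp_eq by (rule sum_cadd)
    finally show "(\<Sum>y\<in>I \<rightarrow>\<^sub>E UNIV. bprob \<delta> I (cadd I y x) * (bsgn (y i) * ?g y))
        = bexp \<delta> I (\<lambda>z. bsgn (z i) * ?g z)" .
  qed
  also have "\<dots> = real (card C) * bexp \<delta> I (\<lambda>z. bsgn (z i) * ?g z)" by simp
  \<comment> \<open>The soft decision ignores coordinate \<open>i\<close>, where the mean sign of
    the noise is \<open>(1 - \<delta>) - \<delta>\<close>.\<close>
  also have "bexp \<delta> I (\<lambda>z. bsgn (z i) * ?g z) = (1 - 2 * \<delta>) * bexp \<delta> I ?g"
  proof -
    have "bexp \<delta> (insert i (I - {i})) (\<lambda>z. bsgn (z i) * ?g z) = bexp \<delta> (I - {i}) (\<lambda>z. (1 - 2 * \<delta>) * ?g z)"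
      using fin by (subst bexp_insert) (simp_all only: ub, simp_all add: bsgn_def algebra_simps)
    moreover have "bexp \<delta> (insert i (I - {i})) ?g = bexp \<delta> (I - {i}) ?g"
      using fin by (subst bexp_insert) (simp_all only: ub, simp_all add: algebra_simps)
    ultimately show ?thesis using I by (simp add: bexp_cmult)
  qed
  finally show ?thesis by (simp only: mult.assoc)
qed

text \<open>
  The entropy of \<open>Y\<close> is at most \<open>ln (card C)\<close> plus that of the noise, so below capacity \<open>Y\<close> is far
  from uniform; tensorization turns this into a bias of the single symbols.
\<close>
lemma soft_dec_mean_ge:
  "real (card I) * ln 2 * (1 - bin_entropy \<delta>) - ln (real (card C))
     \<le> (1 - 2 * \<delta>) * (\<Sum>i\<in>I. bexp \<delta> I (soft_dec \<delta> I C i))"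
proof -
  let ?f = "output_weight \<delta> I C"
  define K where "K = real (card C)"
  \<comment> \<open>Adding \<open>c\<close> to the logarithm of an output weight gives the
    log-density of the output relative to the uniform law.\<close>
  define c where "c = real (card I) * ln 2 - ln K"
  have K: "K > 0" using code_card_pos by (simp add: K_def)
  have "K * (real (card I) * ln 2 * (1 - bin_entropy \<delta>) - ln K)
      = (\<Sum>x\<in>C. bexp \<delta> I (\<lambda>z. c + ln (bprob \<delta> I z)))"
    by (simp only: bexp_add bexp_const[OF fin] bexp_ln_bprob[OF fin \<delta>] sum_constant K_def[symmetric])
      (simp add: c_def algebra_simps)
  also have "\<dots> = (\<Sum>x\<in>C. \<Sum>y\<in>I \<rightarrow>\<^sub>E UNIV. bprob \<delta> I (cadd I y x) * (c + ln (bprob \<delta> I (cadd I y x))))"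
    unfolding bexp_eq using sum_cadd[of "\<lambda>z. bprob \<delta> I z * (c + ln (bprob \<delta> I z))" I] by simp
  \<comment> \<open>A single summand is at most the whole output weight; in entropy terms,
    \<open>Y\<close> carries no more entropy than the pair of codeword and noise.\<close>
  also have "\<dots> \<le> (\<Sum>x\<in>C. \<Sum>y\<in>I \<rightarrow>\<^sub>E UNIV. bprob \<delta> I (cadd I y x) * (c + ln (?f y)))"
  proof (intro sum_mono mult_left_mono add_left_mono)
    fix x y assume "x \<in> C"
    then have "bprob \<delta> I (cadd I y x) \<le> ?f y"
      unfolding output_weight_def using finite_code bprob_pos[OF \<delta>, THEN less_imp_le]
      by (intro member_le_sum) auto
    then show "ln (bprob \<delta> I (cadd I y x)) \<le> ln (?f y)"
      using bprob_pos[OF \<delta>, of I "cadd I y x"] by (subst ln_le_cancel_iff) auto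
  qed (rule less_imp_le[OF bprob_pos[OF \<delta>]])
  also have "\<dots> = (\<Sum>y\<in>I \<rightarrow>\<^sub>E UNIV. ?f y * (c + ln (?f y)))"
    unfolding output_weight_def sum_distrib_right by (rule sum.swap)
  also have "\<dots> = (\<Sum>y\<in>I \<rightarrow>\<^sub>E UNIV. ?f y * ln (2 ^ card I * ?f y / (\<Sum>y\<in>I \<rightarrow>\<^sub>E UNIV. ?f y)))"
    unfolding sum_output_weight K_def[symmetric] c_def using K output_weight_pos
    by (intro sum.cong) (auto simp: ln_div ln_mult_pos ln_realpow)
  also have "\<dots> \<le> (\<Sum>i\<in>I. \<Sum>y\<in>(I - {i}) \<rightarrow>\<^sub>E UNIV. (?f (y(i := 0)) - ?f (y(i := 1)))\<^sup>2 / (?f (y(i := 0)) + ?f (y(i := 1))))"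
    by (rule entropy_tensorization[OF fin output_weight_pos])
  also have "\<dots> = (\<Sum>i\<in>I. K * (1 - 2 * \<delta>) * bexp \<delta> I (soft_dec \<delta> I C i))"
    unfolding K_def by (intro sum.cong sum_soft_dec) auto
  also have "\<dots> = K * ((1 - 2 * \<delta>) * (\<Sum>i\<in>I. bexp \<delta> I (soft_dec \<delta> I C i)))"
    by (simp add: sum_distrib_left mult_ac)
  finally show ?thesis using K by (simp add: K_def)
qed

text \<open>A coordinate permutation that preserves the code also preserves noise probabilities,
  hence output weights. Applied to translations, it makes all positions equivalent.\<close>

lemma soft_dec_permute:
  assumes "\<sigma> ` I \<subseteq> I" "inj_on \<sigma> I" and inv: "\<And>x. x \<in> C \<Longrightarrow> restrict (x \<circ> \<sigma>) I \<in> C"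
    and i: "i \<in> I"
  shows "soft_dec \<delta> I C i (restrict (z \<circ> \<sigma>) I) = soft_dec \<delta> I C (\<sigma> i) z"
proof -
  have \<sigma>: "bij_betw \<sigma> I I" using assms fin by (simp add: bij_betw_def endo_inj_surj)
  let ?R = "\<lambda>x. restrict (x \<circ> \<sigma>) I"
  have injR: "inj_on ?R C"
  proof (rule inj_onI)
    fix x y assume xy: "x \<in> C" "y \<in> C" "?R x = ?R y"
    have E: "x \<in> I \<rightarrow>\<^sub>E UNIV" "y \<in> I \<rightarrow>\<^sub>E UNIV" using xy lin by (auto simp: linear_code_def)
    show "x = y"
    proof (rule PiE_ext[OF E])
      fix j assume "j \<in> I"
      then obtain k where "k \<in> I" "j = \<sigma> k" using \<sigma> by (auto simp: bij_betw_def)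
      then show "x j = y j" using fun_cong[OF xy(3), of k] by simp
    qed
  qed
  have bijR: "bij_betw ?R C C"
    unfolding bij_betw_def using injR inv by (intro conjI endo_inj_surj[OF finite_code]) auto
  have w: "bprob \<delta> I (?R y) = bprob \<delta> I y" for y
  proof -
    have "bprob \<delta> I (?R y) = (\<Prod>j\<in>I. if y (\<sigma> j) = 1 then \<delta> else 1 - \<delta>)"
      by (simp add: bprob_def)
    also have "\<dots> = bprob \<delta> I y"
      unfolding bprob_def by (rule prod.reindex_bij_betw[OF \<sigma>])
    finally show ?thesis .
  qed
  have a: "cadd I (?R y) (?R x) = ?R (cadd I y x)" for x y
    using assms(1) by (auto simp: cadd_def fun_eq_iff)
  have f: "output_weight \<delta> I C (?R y) = output_weight \<delta> I C y" for y
  proof -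
    have "output_weight \<delta> I C (?R y) = (\<Sum>x\<in>C. bprob \<delta> I (cadd I (?R y) (?R x)))"
      unfolding output_weight_def by (rule sum.reindex_bij_betw[OF bijR, symmetric])
    then show ?thesis by (simp add: a w output_weight_def)
  qed
  have "(?R z)(i := b) = ?R (z(\<sigma> i := b))" for b
    using i inj_onD[OF assms(2)] by (fastforce simp: fun_eq_iff)
  then have "output_weight \<delta> I C ((?R z)(i := b)) = output_weight \<delta> I C (z(\<sigma> i := b))" for b
    using f by simp
  then show ?thesis by (simp add: soft_dec_def del: fun_upd_apply)
qed

end

section \<open>Bounding conditional entropy by decoding error\<close>

text \<open>Gibbs' inequality for the unnormalised conditional distributions \<open>q\<close>.\<close>
lemma cond_entropy_le:
  assumes fin: "finite \<Omega>" and p: "\<And>\<omega>. \<omega> \<in> \<Omega> \<Longrightarrow> p \<omega> > 0" and q: "\<And>\<omega>. \<omega> \<in> \<Omega> \<Longrightarrow> q \<omega> > 0"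
    and inj: "inj_on (\<lambda>\<omega>. (X \<omega>, Y \<omega>)) \<Omega>"
    and q1: "\<And>v. (\<Sum>\<omega>\<in>{\<omega>\<in>\<Omega>. Y \<omega> = v}. q \<omega>) \<le> 1"
  shows "cond_entropy p \<Omega> X Y \<le> - (\<Sum>\<omega>\<in>\<Omega>. p \<omega> * log 2 (q \<omega>))"
proof -
  define P where "P v = (\<Sum>\<omega>\<in>{\<omega>\<in>\<Omega>. Y \<omega> = v}. p \<omega>)" for v
  have Ppos: "P (Y \<omega>) > 0" if "\<omega> \<in> \<Omega>" for \<omega>
    unfolding P_def using that fin p by (intro sum_pos) auto
  have "cond_entropy p \<Omega> X Y = - (\<Sum>\<omega>\<in>\<Omega>. p \<omega> * log 2 (p \<omega> / P (Y \<omega>)))"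
  proof -
    \<comment> \<open>Injectivity of the pair makes the joint fibres singletons, so the entropy
      becomes a sum over \<open>\<Omega>\<close>.\<close>
    have "{\<omega>'\<in>\<Omega>. X \<omega>' = X \<omega> \<and> Y \<omega>' = Y \<omega>} = {\<omega>}" if "\<omega> \<in> \<Omega>" for \<omega>
      using that inj by (auto simp: inj_on_def)
    then show ?thesis
      unfolding cond_entropy_def by (subst sum.reindex[OF inj]) (simp add: P_def Let_def)
  qed
  moreover have "(\<Sum>\<omega>\<in>\<Omega>. p \<omega> * log 2 (q \<omega>)) - (\<Sum>\<omega>\<in>\<Omega>. p \<omega> * log 2 (p \<omega> / P (Y \<omega>))) \<le> 0"
  proof -
    have "(\<Sum>\<omega>\<in>\<Omega>. p \<omega> * log 2 (q \<omega>)) - (\<Sum>\<omega>\<in>\<Omega>. p \<omega> * log 2 (p \<omega> / P (Y \<omega>)))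
        = (\<Sum>\<omega>\<in>\<Omega>. p \<omega> * ln (P (Y \<omega>) * q \<omega> / p \<omega>)) / ln 2"
      unfolding sum_subtractf[symmetric] sum_divide_distrib using p q Ppos
      by (intro sum.cong refl)
        (simp add: log_def ln_div ln_mult_pos less_imp_neq[symmetric] right_diff_distrib distrib_left
          diff_divide_distrib add_divide_distrib)
    moreover have "(\<Sum>\<omega>\<in>\<Omega>. p \<omega> * ln (P (Y \<omega>) * q \<omega> / p \<omega>)) \<le> (\<Sum>\<omega>\<in>\<Omega>. P (Y \<omega>) * q \<omega> - p \<omega>)"
    proof (rule sum_mono)
      fix \<omega> assume w: "\<omega> \<in> \<Omega>"
      have "p \<omega> * ln (P (Y \<omega>) * q \<omega> / p \<omega>) \<le> p \<omega> * (P (Y \<omega>) * q \<omega> / p \<omega> - 1)"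
        using p[OF w] q[OF w] Ppos[OF w] by (intro mult_left_mono ln_le_minus_one) auto
      then show "p \<omega> * ln (P (Y \<omega>) * q \<omega> / p \<omega>) \<le> P (Y \<omega>) * q \<omega> - p \<omega>"
        using p[OF w] by (simp add: right_diff_distrib)
    qed
    moreover have "(\<Sum>\<omega>\<in>\<Omega>. P (Y \<omega>) * q \<omega>) \<le> (\<Sum>\<omega>\<in>\<Omega>. p \<omega>)"
    proof -
      have "(\<Sum>\<omega>\<in>\<Omega>. P (Y \<omega>) * q \<omega>) = (\<Sum>v\<in>Y ` \<Omega>. \<Sum>\<omega>\<in>{\<omega>\<in>\<Omega>. Y \<omega> = v}. P (Y \<omega>) * q \<omega>)"
        by (rule sum.image_gen[OF fin])
      also have "\<dots> = (\<Sum>v\<in>Y ` \<Omega>. P v * (\<Sum>\<omega>\<in>{\<omega>\<in>\<Omega>. Y \<omega> = v}. q \<omega>))"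
        by (simp add: sum_distrib_left)
      also have "\<dots> \<le> (\<Sum>v\<in>Y ` \<Omega>. P v)"
        using q1 Ppos by (intro sum_mono mult_left_le) (auto simp: less_imp_le)
      also have "\<dots> = (\<Sum>\<omega>\<in>\<Omega>. p \<omega>)"
        unfolding P_def by (rule sum.image_gen[OF fin, symmetric])
      finally show ?thesis .
    qed
    ultimately show ?thesis
      by (simp add: sum_subtractf divide_le_0_iff)
  qed
  ultimately show ?thesis by linarith
qed

text \<open>Deciding symbols by the sign of \<open>G\<close> leaves an error pattern that identifies
  \<open>z\<close> within its coset. Describing the pattern as if its bits were independent
  Bernoulli(\<open>t\<close>) costs on average at most \<open>bin_entropy t\<close> bits per
  position.\<close>

lemma cond_entropy_le_bin_entropy:
  assumes fin: "finite I" and \<delta>: "0 < \<delta>" "\<delta> < 1" and t: "0 < t" "t \<le> 1/2"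
    and G: "\<And>i x z. i \<in> I \<Longrightarrow> x \<in> C \<Longrightarrow> z \<in> I \<rightarrow>\<^sub>E UNIV \<Longrightarrow> G i (cadd I z x) = bsgn (x i) * G i z"
    and err: "\<And>i. i \<in> I \<Longrightarrow> bexp \<delta> I (\<lambda>z. if G i z \<le> 0 then 1 else 0) \<le> t"
    and inj: "inj_on (\<lambda>z. (X z, Y z)) (I \<rightarrow>\<^sub>E UNIV)"
    and coset: "\<And>z z'. z \<in> I \<rightarrow>\<^sub>E UNIV \<Longrightarrow> z' \<in> I \<rightarrow>\<^sub>E UNIV \<Longrightarrow> Y z = Y z' \<Longrightarrow> cadd I z z' \<in> C"
  shows "cond_entropy (bprob \<delta> I) (I \<rightarrow>\<^sub>E UNIV) X Y \<le> real (card I) * bin_entropy t"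
proof -
  \<comment> \<open>The tie-break for \<open>G i z = 0\<close> makes the coset of \<open>z\<close> and its error pattern determine \<open>z\<close>.\<close>
  define wrong where "wrong i z \<longleftrightarrow> G i z < 0 \<or> G i z = 0 \<and> z i = 1" for i z
  define E :: "('a \<Rightarrow> bit) \<Rightarrow> 'a \<Rightarrow> bit" where "E z = restrict (\<lambda>i. of_bool (wrong i z)) I" for z
  have finPi: "finite (I \<rightarrow>\<^sub>E (UNIV::bit set))" using fin by (intro finite_PiE) auto
  have injE: "inj_on E {z \<in> I \<rightarrow>\<^sub>E UNIV. Y z = v}" for v
  proof (rule inj_onI)
    fix z z' assume a: "z \<in> {z \<in> I \<rightarrow>\<^sub>E UNIV. Y z = v}" "z' \<in> {z \<in> I \<rightarrow>\<^sub>E UNIV. Y z = v}" "E z = E z'"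
    then have z: "z \<in> I \<rightarrow>\<^sub>E UNIV" "z' \<in> I \<rightarrow>\<^sub>E UNIV" "Y z = Y z'" by auto
    define x where "x = cadd I z z'"
    have xC: "x \<in> C" unfolding x_def by (rule coset[OF z])
    have z': "z' = cadd I z x" using cadd_cancel[OF z(2), of z] by (simp add: x_def cadd_commute)
    show "z = z'"
    proof (rule PiE_ext[OF z(1,2)])
      fix i assume i: "i \<in> I"
      have w: "wrong i z \<longleftrightarrow> wrong i z'" using fun_cong[OF a(3), of i] i
        by (simp add: E_def of_bool_def split: if_splits)
      have g: "G i z' = bsgn (x i) * G i z" unfolding z' by (rule G[OF i xC z(1)])
      have xi: "x i = z i + z' i" using i by (simp add: x_def cadd_def)
      show "z i = z' i"
        using w g xi by (cases "z i"; cases "z' i") (auto simp: wrong_def bsgn_def)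
    qed
  qed
  have "cond_entropy (bprob \<delta> I) (I \<rightarrow>\<^sub>E UNIV) X Y
      \<le> - (\<Sum>z\<in>I \<rightarrow>\<^sub>E UNIV. bprob \<delta> I z * log 2 (bprob t I (E z)))"
  proof (rule cond_entropy_le[OF finPi _ _ inj])
    fix v
    have "(\<Sum>z\<in>{z \<in> I \<rightarrow>\<^sub>E UNIV. Y z = v}. bprob t I (E z)) = (\<Sum>e\<in>E ` {z \<in> I \<rightarrow>\<^sub>E UNIV. Y z = v}. bprob t I e)"
      by (simp add: sum.reindex[OF injE])
    also have "\<dots> \<le> (\<Sum>e\<in>I \<rightarrow>\<^sub>E UNIV. bprob t I e)"
      using finPi bprob_pos[of t I] t by (intro sum_mono2) (auto simp: E_def less_imp_le)
    finally show "(\<Sum>z\<in>{z \<in> I \<rightarrow>\<^sub>E UNIV. Y z = v}. bprob t I (E z)) \<le> 1"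
      using fin by (simp add: sum_bprob)
  qed (use bprob_pos[OF \<delta>] bprob_pos[of t] t in auto)
  also have "\<dots> = (\<Sum>i\<in>I. bexp \<delta> I (\<lambda>z. - log 2 (1 - t) + (log 2 (1 - t) - log 2 t) * of_bool (wrong i z)))"
  proof -
    have "- log 2 (bprob t I (E z)) = (\<Sum>i\<in>I. - log 2 (1 - t) + (log 2 (1 - t) - log 2 t) * of_bool (wrong i z))" for z
    proof -
      have "- log 2 (bprob t I (E z)) = - (\<Sum>i\<in>I. ln (if E z i = 1 then t else 1 - t)) / ln 2"
        unfolding bprob_def log_def using t by (subst ln_prod[OF fin]) auto
      also have "\<dots> = (\<Sum>i\<in>I. - log 2 (1 - t) + (log 2 (1 - t) - log 2 t) * of_bool (wrong i z))"
        unfolding sum_divide_distrib sum_negf[symmetric] minus_divide_left[symmetric]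
        by (intro sum.cong) (auto simp: E_def log_def)
      finally show ?thesis .
    qed
    moreover have "- (\<Sum>z\<in>I \<rightarrow>\<^sub>E UNIV. bprob \<delta> I z * log 2 (bprob t I (E z)))
        = bexp \<delta> I (\<lambda>z. - log 2 (bprob t I (E z)))"
      by (simp add: bexp_eq sum_negf)
    ultimately show ?thesis by (simp only: bexp_sum)
  qed
  also have "\<dots> \<le> (\<Sum>i\<in>I. bin_entropy t)"
  proof (rule sum_mono)
    fix i assume i: "i \<in> I"
    \<comment> \<open>Because \<open>t \<le> 1/2\<close>, an error costs at least as much as a
      correct bit, so the mean cost increases with the error probability.\<close>
    have mono: "log 2 t \<le> log 2 (1 - t)" using t by simp
    have "bexp \<delta> I (\<lambda>z. - log 2 (1 - t) + (log 2 (1 - t) - log 2 t) * of_bool (wrong i z))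
        = - log 2 (1 - t) + (log 2 (1 - t) - log 2 t) * bexp \<delta> I (\<lambda>z. of_bool (wrong i z))"
      by (simp only: bexp_add bexp_cmult bexp_const[OF fin])
    also have "\<dots> \<le> - log 2 (1 - t) + (log 2 (1 - t) - log 2 t) * t"
    proof (intro add_left_mono mult_left_mono)
      have "bexp \<delta> I (\<lambda>z. of_bool (wrong i z)) \<le> bexp \<delta> I (\<lambda>z. if G i z \<le> 0 then 1 else 0)"
        using \<delta> by (intro bexp_mono) (auto simp: wrong_def)
      then show "bexp \<delta> I (\<lambda>z. of_bool (wrong i z)) \<le> t" using err[OF i] by linarith
    qed (use mono in simp)
    also have "\<dots> = bin_entropy t" by (simp add: bin_entropy_def algebra_simps)
    finally show "bexp \<delta> I (\<lambda>z. - log 2 (1 - t) + (log 2 (1 - t) - log 2 t) * of_bool (wrong i z)) \<le> bin_entropy t" .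
  qed
  finally show ?thesis by simp
qed

section \<open>Reed--Muller codes\<close>

lemma bit_add_eq_0_iff: "(a::bit) + b = 0 \<longleftrightarrow> a = b"
  by (cases a; cases b) auto

lemma prod_bit: "finite S \<Longrightarrow> (\<Prod>i\<in>S. x i :: bit) = of_bool (\<forall>i\<in>S. x i = 1)"
  by (induction S rule: finite_induct) auto

lemma bij_betw_points: "bij_betw (\<lambda>x. restrict x {..<m}) (points m) ({..<m} \<rightarrow>\<^sub>E UNIV)"
proof (rule bij_betw_byWitness[where f' = "\<lambda>x i. if i < m then x i else 0"])
  show "\<forall>a\<in>points m. (\<lambda>i. if i < m then restrict a {..<m} i else 0) = a"
    by (auto simp: points_def fun_eq_iff)
  show "\<forall>a\<in>{..<m} \<rightarrow>\<^sub>E UNIV. restrict (\<lambda>i. if i < m then a i else 0) {..<m} = a"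
    by (intro ballI PiE_ext[of _ "{..<m}" "\<lambda>_. UNIV"]) auto
  show "(\<lambda>x. restrict x {..<m}) ` points m \<subseteq> {..<m} \<rightarrow>\<^sub>E UNIV"
    by (intro image_subsetI) (simp add: restrict_PiE_iff del: restrict_apply)
  show "(\<lambda>x i. if i < m then x i else 0) ` ({..<m} \<rightarrow>\<^sub>E UNIV) \<subseteq> points m"
    by (intro image_subsetI) (simp add: points_def)
qed

lemma finite_points [simp]: "finite (points m)"
  using bij_betw_finite[OF bij_betw_points] by (simp add: finite_PiE)

lemma card_points: "card (points m) = 2 ^ m"
  using bij_betw_same_card[OF bij_betw_points, of m] by (simp add: card_PiE)

lemma zero_in_points [simp]: "(\<lambda>_. 0) \<in> points m"
  by (simp add: points_def)

definition low_degree :: "nat \<Rightarrow> nat \<Rightarrow> ((nat \<Rightarrow> bit) \<Rightarrow> bit) \<Rightarrow> bool" where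
  "low_degree m r f \<longleftrightarrow>
     (\<exists>c. (\<forall>S\<in>Pow {..<m}. r < card S \<longrightarrow> c S = 0) \<and> (\<forall>x\<in>points m. f x = mlpoly_eval m c x))"

lemma low_degree_cong: "low_degree m r f \<Longrightarrow> (\<And>x. x \<in> points m \<Longrightarrow> f x = g x) \<Longrightarrow> low_degree m r g"
  unfolding low_degree_def by auto

lemma low_degree_mono: "low_degree m r f \<Longrightarrow> r \<le> s \<Longrightarrow> low_degree m s f"
  unfolding low_degree_def by (meson le_less_trans)

lemma mlpoly_eval_add: "mlpoly_eval m (\<lambda>S. c S + d S) x = mlpoly_eval m c x + mlpoly_eval m d x"
  unfolding mlpoly_eval_def by (simp only: distrib_right sum.distrib)

lemma low_degree_add:
  assumes "low_degree m r f" "low_degree m r g"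
  shows "low_degree m r (\<lambda>x. f x + g x)"
proof -
  obtain c d where "\<forall>S\<in>Pow {..<m}. r < card S \<longrightarrow> c S = 0" "\<forall>x\<in>points m. f x = mlpoly_eval m c x"
    "\<forall>S\<in>Pow {..<m}. r < card S \<longrightarrow> d S = 0" "\<forall>x\<in>points m. g x = mlpoly_eval m d x"
    using assms unfolding low_degree_def by blast
  then show ?thesis
    unfolding low_degree_def by (intro exI[of _ "\<lambda>S. c S + d S"]) (auto simp: mlpoly_eval_add)
qed

lemma low_degree_0: "low_degree m r (\<lambda>_. 0)"
  unfolding low_degree_def by (intro exI[of _ "\<lambda>_. 0"]) (simp add: mlpoly_eval_def)

lemma low_degree_sum: "(\<And>a. a \<in> T \<Longrightarrow> low_degree m r (f a)) \<Longrightarrow> low_degree m r (\<lambda>x. \<Sum>a\<in>T. f a x)"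
  by (induction T rule: infinite_finite_induct) (simp_all add: low_degree_0 low_degree_add)

lemma low_degree_monomial:
  assumes "S \<subseteq> {..<m}" "card S \<le> r"
  shows "low_degree m r (\<lambda>x. \<Prod>i\<in>S. x i)"
proof -
  have "mlpoly_eval m (\<lambda>T. of_bool (T = S)) x = (\<Prod>i\<in>S. x i)" for x
  proof -
    have "mlpoly_eval m (\<lambda>T. of_bool (T = S)) x = (\<Sum>T\<in>Pow {..<m}. if T = S then \<Prod>i\<in>T. x i else 0)"
      unfolding mlpoly_eval_def by (intro sum.cong) auto
    then show ?thesis using assms by (simp only: sum.delta finite_Pow_iff finite_lessThan) simp
  qed
  then show ?thesis
    unfolding low_degree_def using assms by (intro exI[of _ "\<lambda>T. of_bool (T = S)"]) auto
qed

lemma low_degree_const: "low_degree m r (\<lambda>_. b)"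
  using low_degree_monomial[of "{}" m r] by (cases b) (auto simp: low_degree_0)

lemma low_degree_coord: "low_degree m 1 (\<lambda>x. x i)"
proof (cases "i < m")
  case True
  then show ?thesis using low_degree_monomial[of "{i}" m 1] by simp
next
  case False
  then show ?thesis by (intro low_degree_cong[OF low_degree_0]) (auto simp: points_def)
qed

lemma low_degree_scale: "low_degree m r f \<Longrightarrow> low_degree m r (\<lambda>x. b * f x)"
  by (cases b) (simp_all add: low_degree_0)

text \<open>Bits are idempotent, so the product of the monomials of \<open>S\<close> and
  \<open>T\<close> is that of \<open>S \<union> T\<close>, whose size is at most the sum of the two
  sizes.\<close>

lemma low_degree_mult:
  assumes "low_degree m r f" "low_degree m s g"
  shows "low_degree m (r + s) (\<lambda>x. f x * g x)"
proof -
  obtain c d where c: "\<forall>S\<in>Pow {..<m}. r < card S \<longrightarrow> c S = 0" "\<forall>x\<in>points m. f x = mlpoly_eval m c x"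
    and d: "\<forall>S\<in>Pow {..<m}. s < card S \<longrightarrow> d S = 0" "\<forall>x\<in>points m. g x = mlpoly_eval m d x"
    using assms unfolding low_degree_def by blast
  have "low_degree m (r + s) (\<lambda>x. \<Sum>S\<in>Pow {..<m}. \<Sum>T\<in>Pow {..<m}. (c S * d T) * (\<Prod>i\<in>S \<union> T. x i))"
  proof (intro low_degree_sum)
    fix S T assume ST: "S \<in> Pow {..<m}" "T \<in> Pow {..<m}"
    show "low_degree m (r + s) (\<lambda>x. (c S * d T) * (\<Prod>i\<in>S \<union> T. x i))"
    proof (cases "card S \<le> r \<and> card T \<le> s")
      case True
      then have "card (S \<union> T) \<le> r + s" using card_Un_le[of S T] by linarith
      then show ?thesis using ST by (intro low_degree_scale low_degree_monomial) auto
    next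
      case False
      then have "c S * d T = 0" using ST c(1) d(1) by (auto simp: not_le)
      then show ?thesis using low_degree_0 by (simp only: mult_zero_left)
    qed
  qed
  moreover have "(\<Sum>S\<in>Pow {..<m}. \<Sum>T\<in>Pow {..<m}. (c S * d T) * (\<Prod>i\<in>S \<union> T. x i)) = f x * g x"
    if "x \<in> points m" for x
  proof -
    have "(\<Prod>i\<in>S \<union> T. x i) = (\<Prod>i\<in>S. x i) * (\<Prod>i\<in>T. x i)" if "S \<in> Pow {..<m}" "T \<in> Pow {..<m}" for S T
      using that finite_subset[of S "{..<m}"] finite_subset[of T "{..<m}"] by (auto simp: prod_bit)
    then have "(\<Sum>S\<in>Pow {..<m}. \<Sum>T\<in>Pow {..<m}. (c S * d T) * (\<Prod>i\<in>S \<union> T. x i))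
        = (\<Sum>S\<in>Pow {..<m}. \<Sum>T\<in>Pow {..<m}. (c S * (\<Prod>i\<in>S. x i)) * (d T * (\<Prod>i\<in>T. x i)))"
      by (intro sum.cong refl) (simp only: mult_ac)
    also have "\<dots> = mlpoly_eval m c x * mlpoly_eval m d x"
      unfolding mlpoly_eval_def sum_product ..
    finally show ?thesis using c d that by simp
  qed
  ultimately show ?thesis by (rule low_degree_cong)
qed

lemma low_degree_prod:
  assumes "finite S" "\<And>i. i \<in> S \<Longrightarrow> low_degree m 1 (f i)"
  shows "low_degree m (card S) (\<lambda>x. \<Prod>i\<in>S. f i x)"
  using assms
proof (induction S rule: finite_induct)
  case (insert a S)
  then have "low_degree m (1 + card S) (\<lambda>x. f a x * (\<Prod>i\<in>S. f i x))"
    by (intro low_degree_mult) auto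
  then show ?case using insert.hyps by simp
qed (simp add: low_degree_const)

text \<open>Substituting affine forms into a monomial does not raise its degree. Hence the codes are
  stable under restriction to subspaces and under translation.\<close>

lemma low_degree_comp:
  assumes f: "low_degree m r f" and A: "A ` points n \<subseteq> points m"
    and aff: "\<And>i. i < m \<Longrightarrow> low_degree n 1 (\<lambda>u. A u i)"
  shows "low_degree n r (f \<circ> A)"
proof -
  obtain c where c: "\<forall>S\<in>Pow {..<m}. r < card S \<longrightarrow> c S = 0" "\<forall>x\<in>points m. f x = mlpoly_eval m c x"
    using f unfolding low_degree_def by blast
  have "low_degree n r (\<lambda>u. \<Sum>S\<in>Pow {..<m}. c S * (\<Prod>i\<in>S. A u i))"
  proof (intro low_degree_sum)
    fix S assume S: "S \<in> Pow {..<m}"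
    show "low_degree n r (\<lambda>u. c S * (\<Prod>i\<in>S. A u i))"
    proof (cases "card S \<le> r")
      case True
      have "low_degree n (card S) (\<lambda>u. \<Prod>i\<in>S. A u i)"
        using S aff by (intro low_degree_prod) (auto intro: finite_subset)
      then show ?thesis using True by (intro low_degree_scale) (rule low_degree_mono)
    next
      case False
      then have "c S = 0" using S c(1) by (auto simp: not_le)
      then show ?thesis using low_degree_0 by (simp only: mult_zero_left)
    qed
  qed
  then show ?thesis
    using A c(2) by (elim low_degree_cong) (auto simp: mlpoly_eval_def)
qed

definition reed_muller :: "nat \<Rightarrow> nat \<Rightarrow> ((nat \<Rightarrow> bit) \<Rightarrow> bit) set" where
  "reed_muller m r = {f \<in> configs m. low_degree m r f}"

lemma reed_muller_comp:
  assumes "f \<in> reed_muller m r" "A ` points n \<subseteq> points m" "\<And>i. i < m \<Longrightarrow> low_degree n 1 (\<lambda>u. A u i)"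
  shows "restrict (f \<circ> A) (points n) \<in> reed_muller n r"
  using low_degree_comp[of m r f A n] assms
  unfolding reed_muller_def configs_def by (auto elim!: low_degree_cong)

lemma linear_code_reed_muller: "linear_code (points m) (reed_muller m r)"
  unfolding linear_code_def
proof (intro conjI ballI)
  have "restrict (\<lambda>_. 0) (points m) \<in> reed_muller m r"
    unfolding reed_muller_def configs_def by (auto intro: low_degree_cong[OF low_degree_0])
  then show "reed_muller m r \<noteq> {}" by auto
  fix x y assume "x \<in> reed_muller m r" "y \<in> reed_muller m r"
  then show "cadd (points m) x y \<in> reed_muller m r"
    unfolding reed_muller_def configs_def
    by (auto simp: cadd_def intro: low_degree_cong[OF low_degree_add])
qed (auto simp: reed_muller_def configs_def)

section \<open>Code size and the multilinear coefficients\<close>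

lemma card_low_subsets: "card {S \<in> Pow {..<m}. card S \<le> r} = binom_le m r"
proof -
  have "{S \<in> Pow {..<m}. card S \<le> r} = (\<Union>i\<in>{..r}. {S. S \<subseteq> {..<m} \<and> card S = i})" by auto
  also have "card \<dots> = (\<Sum>i\<le>r. card {S. S \<subseteq> {..<m} \<and> card S = i})"
    by (rule card_UN_disjoint) auto
  finally show ?thesis by (simp add: n_subsets binom_le_def)
qed

text \<open>Every codeword comes from coefficients on the sets of size at most \<open>r\<close>. The
  logarithm of the code size is what \<open>soft_dec_mean_ge\<close> subtracts.\<close>

lemma card_reed_muller_le: "card (reed_muller m r) \<le> 2 ^ binom_le m r"
proof -
  let ?L = "{S \<in> Pow {..<m}. card S \<le> r}"
  let ?e = "\<lambda>c. restrict (mlpoly_eval m (\<lambda>S. if S \<in> ?L then c S else 0)) (points m)"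
  have "reed_muller m r \<subseteq> ?e ` (?L \<rightarrow>\<^sub>E UNIV)"
  proof
    fix f assume f: "f \<in> reed_muller m r"
    then obtain c where c: "\<forall>S\<in>Pow {..<m}. r < card S \<longrightarrow> c S = 0" "\<forall>x\<in>points m. f x = mlpoly_eval m c x"
      unfolding reed_muller_def low_degree_def by blast
    have "f = ?e (restrict c ?L)"
    proof (rule PiE_ext[of _ "points m" "\<lambda>_. UNIV"])
      show "f \<in> points m \<rightarrow>\<^sub>E UNIV" using f by (simp add: reed_muller_def configs_def)
      fix x assume "x \<in> points m"
      then show "f x = ?e (restrict c ?L) x"
        using c by (auto simp: mlpoly_eval_def not_le intro!: sum.cong simp del: sum_mult_of_bool_eq)
    qed auto
    moreover have "restrict c ?L \<in> ?L \<rightarrow>\<^sub>E UNIV" by (simp add: restrict_PiE_iff)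
    ultimately show "f \<in> ?e ` (?L \<rightarrow>\<^sub>E UNIV)" by (rule image_eqI)
  qed
  moreover have finL: "finite (?L \<rightarrow>\<^sub>E (UNIV::bit set))" by (intro finite_PiE) simp_all
  ultimately have "card (reed_muller m r) \<le> card (?e ` (?L \<rightarrow>\<^sub>E (UNIV::bit set)))"
    by (intro card_mono finite_imageI)
  also have "\<dots> \<le> card (?L \<rightarrow>\<^sub>E (UNIV::bit set))"
    by (rule card_image_le[OF finL])
  also have "\<dots> = 2 ^ binom_le m r"
    by (subst card_PiE) (simp_all add: card_low_subsets[simplified])
  finally show ?thesis .
qed

text \<open>At the indicator of \<open>S\<close> only monomials of subsets of \<open>S\<close>
  survive, and those of proper subsets vanish by induction on the size.\<close>

lemma mlpoly_eval_eq_0: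
  assumes "\<forall>x\<in>points m. mlpoly_eval m c x = 0" "S \<in> Pow {..<m}"
  shows "c S = 0"
  using assms(2)
proof (induction "card S" arbitrary: S rule: less_induct)
  case less
  have fS: "finite S" using less.prems by (auto intro: finite_subset)
  have "mlpoly_eval m c (\<lambda>i. of_bool (i \<in> S)) = (\<Sum>T\<in>Pow {..<m}. if T = S then c S else 0)"
    unfolding mlpoly_eval_def
  proof (intro sum.cong refl)
    fix T assume T: "T \<in> Pow {..<m}"
    then have fT: "finite T" by (auto intro: finite_subset)
    show "c T * (\<Prod>i\<in>T. of_bool (i \<in> S)) = (if T = S then c S else 0)"
    proof (cases "T \<subset> S")
      case True
      then show ?thesis using less.hyps[of T] T psubset_card_mono[OF fS True] by auto
    qed (auto simp: prod_bit[OF fT])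
  qed
  also have "\<dots> = c S" using less.prems by (simp only: sum.delta finite_Pow_iff finite_lessThan) simp
  finally have "c S = mlpoly_eval m c (\<lambda>i. of_bool (i \<in> S))" ..
  moreover have "(\<lambda>i. of_bool (i \<in> S)) \<in> points m" using less.prems by (auto simp: points_def)
  ultimately show ?case using assms(1) by simp
qed

text \<open>Existence follows from uniqueness by counting.\<close>
lemma ex1_ml_coeffs:
  "\<exists>!c. (\<forall>S. S \<notin> Pow {..<m} \<longrightarrow> c S = 0) \<and> (\<forall>x\<in>points m. mlpoly_eval m c x = Z x)"
proof (rule ex_ex1I)
  let ?e = "\<lambda>c. restrict (mlpoly_eval m c) (points m)"
  have inj: "inj_on ?e (Pow {..<m} \<rightarrow>\<^sub>E UNIV)"
  proof (rule inj_onI)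
    fix c d :: "nat set \<Rightarrow> bit"
    assume cd: "c \<in> Pow {..<m} \<rightarrow>\<^sub>E UNIV" "d \<in> Pow {..<m} \<rightarrow>\<^sub>E UNIV" "?e c = ?e d"
    have "\<forall>x\<in>points m. mlpoly_eval m (\<lambda>S. c S + d S) x = 0"
    proof
      fix x assume "x \<in> points m"
      then show "mlpoly_eval m (\<lambda>S. c S + d S) x = 0"
        using fun_cong[OF cd(3), of x] by (simp add: mlpoly_eval_add)
    qed
    then have "c S = d S" if "S \<in> Pow {..<m}" for S
      using mlpoly_eval_eq_0[OF _ that, of "\<lambda>S. c S + d S"] by (simp only: bit_add_eq_0_iff)
    then show "c = d" using cd by (intro PiE_ext[OF cd(1,2)])
  qed
  have "?e ` (Pow {..<m} \<rightarrow>\<^sub>E UNIV) = points m \<rightarrow>\<^sub>E UNIV"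
  proof (rule card_subset_eq)
    show "finite (points m \<rightarrow>\<^sub>E (UNIV :: bit set))" by (intro finite_PiE) auto
    show "card (?e ` (Pow {..<m} \<rightarrow>\<^sub>E UNIV)) = card (points m \<rightarrow>\<^sub>E (UNIV :: bit set))"
      unfolding card_image[OF inj] by (simp add: card_PiE card_points card_Pow)
  qed auto
  then have "restrict Z (points m) \<in> ?e ` (Pow {..<m} \<rightarrow>\<^sub>E UNIV)" by simp
  then obtain c where c: "restrict Z (points m) = ?e c" by (rule imageE)
  have "mlpoly_eval m (\<lambda>S. if S \<in> Pow {..<m} then c S else 0) x = Z x" if "x \<in> points m" for x
    using fun_cong[OF c, of x] that by (simp add: mlpoly_eval_def)
  then show "\<exists>c. (\<forall>S. S \<notin> Pow {..<m} \<longrightarrow> c S = 0) \<and> (\<forall>x\<in>points m. mlpoly_eval m c x = Z x)"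
    by (intro exI[of _ "\<lambda>S. if S \<in> Pow {..<m} then c S else 0"]) auto
next
  fix c d assume c: "(\<forall>S. S \<notin> Pow {..<m} \<longrightarrow> c S = 0) \<and> (\<forall>x\<in>points m. mlpoly_eval m c x = Z x)"
    and d: "(\<forall>S. S \<notin> Pow {..<m} \<longrightarrow> d S = 0) \<and> (\<forall>x\<in>points m. mlpoly_eval m d x = Z x)"
  have "\<forall>x\<in>points m. mlpoly_eval m (\<lambda>S. c S + d S) x = 0"
    using c d by (simp add: mlpoly_eval_add)
  then have "c S = d S" if "S \<in> Pow {..<m}" for S
    using mlpoly_eval_eq_0[OF _ that, of "\<lambda>S. c S + d S"] by (simp only: bit_add_eq_0_iff)
  moreover have "c S = d S" if "S \<notin> Pow {..<m}" for S
    using c d that by simp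
  ultimately show "c = d" by blast
qed

lemma mlpoly_eval_ml_coeffs: "x \<in> points m \<Longrightarrow> mlpoly_eval m (ml_coeffs m Z) x = Z x"
  using theI'[OF ex1_ml_coeffs[of m Z]] unfolding ml_coeffs_def by blast

text \<open>Equal high coefficients cancel in the sum, so conditioning on \<open>W_high\<close>
  reveals the coset of the noise modulo the code.\<close>

lemma W_high_eq_imp_cadd_reed_muller:
  assumes "W_high m r z = W_high m r z'"
  shows "cadd (points m) z z' \<in> reed_muller m r"
proof -
  let ?c = "\<lambda>S. ml_coeffs m z S + ml_coeffs m z' S"
  have "?c S = 0" if "S \<in> Pow {..<m}" "r < card S" for S
    using fun_cong[OF assms, of S] that by (simp add: W_high_def)
  moreover have "cadd (points m) z z' x = mlpoly_eval m ?c x" if "x \<in> points m" for x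
    using that by (simp only: mlpoly_eval_add mlpoly_eval_ml_coeffs cadd_def restrict_apply')
  ultimately show ?thesis
    by (auto simp: reed_muller_def configs_def low_degree_def intro!: exI[of _ ?c])
qed

lemma inj_on_W: "inj_on (\<lambda>z. (W_low m r z, W_high m r z)) (points m \<rightarrow>\<^sub>E UNIV)"
proof (rule inj_onI)
  fix z z' :: "(nat \<Rightarrow> bit) \<Rightarrow> bit"
  assume z: "z \<in> points m \<rightarrow>\<^sub>E UNIV" "z' \<in> points m \<rightarrow>\<^sub>E UNIV"
    and "(W_low m r z, W_high m r z) = (W_low m r z', W_high m r z')"
  then have W: "W_low m r z S = W_low m r z' S" "W_high m r z S = W_high m r z' S" for S
    by simp_all
  have "ml_coeffs m z S = ml_coeffs m z' S" if "S \<in> Pow {..<m}" for S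
  proof (cases "card S \<le> r")
    case True
    then show ?thesis using W(1)[of S] that by (simp add: W_low_def)
  next
    case False
    then show ?thesis using W(2)[of S] that by (simp add: W_high_def)
  qed
  then have "mlpoly_eval m (ml_coeffs m z) x = mlpoly_eval m (ml_coeffs m z') x" for x
    by (simp add: mlpoly_eval_def)
  then show "z = z'"
    using mlpoly_eval_ml_coeffs[of _ m z] mlpoly_eval_ml_coeffs[of _ m z'] by (intro PiE_ext[OF z]) simp
qed

section \<open>Boosting by voting over subspaces\<close>

text \<open>Chebyshev's inequality: a nonpositive value deviates from the positive mean by at least
  that mean.\<close>

lemma bexp_nonpos_le:
  assumes "finite I" "0 \<le> \<delta>" "\<delta> \<le> 1" and E: "0 < bexp \<delta> I G"
  shows "bexp \<delta> I (\<lambda>z. if G z \<le> 0 then 1 else 0) \<le> bvar \<delta> I G / (bexp \<delta> I G)\<^sup>2"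
proof -
  let ?E = "bexp \<delta> I G"
  have "bexp \<delta> I (\<lambda>z. if G z \<le> 0 then 1 else 0) \<le> bexp \<delta> I (\<lambda>z. (1 / ?E\<^sup>2) * (G z - ?E)\<^sup>2)"
  proof (rule bexp_mono)
    fix z
    have "?E\<^sup>2 \<le> (G z - ?E)\<^sup>2" if "G z \<le> 0"
      using that E abs_le_square_iff[of ?E "G z - ?E"] by simp
    then show "(if G z \<le> 0 then 1 else 0) \<le> (1 / ?E\<^sup>2) * (G z - ?E)\<^sup>2"
      using E by (simp add: field_simps)
  qed (use assms in auto)
  also have "\<dots> = (1 / ?E\<^sup>2) * bvar \<delta> I G"
  proof -
    have "bexp \<delta> I (\<lambda>z. (G z - ?E)\<^sup>2) = bexp \<delta> I (\<lambda>z. (G z)\<^sup>2 + ((- 2 * ?E) * G z + ?E\<^sup>2))"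
      by (intro bexp_cong) (simp add: power2_eq_square algebra_simps)
    also have "\<dots> = bvar \<delta> I G"
      by (simp only: bexp_add bexp_cmult bexp_const[OF assms(1)] bvar_def) (simp add: power2_eq_square)
    finally show ?thesis by (simp only: bexp_cmult)
  qed
  finally show ?thesis by simp
qed

lemma restrict_cadd_comp:
  "A ` J \<subseteq> I \<Longrightarrow> restrict (cadd I z x \<circ> A) J = cadd J (restrict (z \<circ> A) J) (restrict (x \<circ> A) J)"
  by (auto simp: cadd_def fun_eq_iff)

section \<open>Translations and random subspaces\<close>

definition translate :: "(nat \<Rightarrow> bit) \<Rightarrow> (nat \<Rightarrow> bit) \<Rightarrow> nat \<Rightarrow> bit" where
  "translate t x = (\<lambda>i. x i + t i)"

lemma translate_points: "t \<in> points m \<Longrightarrow> translate t ` points m \<subseteq> points m"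
  by (auto simp: translate_def points_def)

lemma inj_translate: "inj_on (translate t) S"
  by (auto simp: inj_on_def translate_def fun_eq_iff)

lemma low_degree_translate: "low_degree m 1 (\<lambda>u. translate t u i)"
  unfolding translate_def by (intro low_degree_add low_degree_coord low_degree_const)

lemma translate_zero: "translate t (\<lambda>_. 0) = t"
  by (simp add: translate_def)

lemma reed_muller_translate:
  assumes "x \<in> reed_muller m r" "t \<in> points m"
  shows "restrict (x \<circ> translate t) (points m) \<in> reed_muller m r"
  by (rule reed_muller_comp[OF assms(1) translate_points[OF assms(2)] low_degree_translate])

text \<open>
  The graphs of the linear slope_matrices \<open>F_2^m \<rightarrow> F_2^k\<close> form a family of \<open>m\<close>-dimensional subspaces of
  \<open>F_2^(m + k)\<close> in which every nonzero point lies in at most a fraction \<open>2^-k\<close> of the members.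
\<close>
definition graph_map :: "nat \<Rightarrow> nat \<Rightarrow> (nat \<Rightarrow> nat \<Rightarrow> bit) \<Rightarrow> (nat \<Rightarrow> bit) \<Rightarrow> nat \<Rightarrow> bit" where
  "graph_map m k B u =
     (\<lambda>i. if i < m then u i else if i < m + k then \<Sum>l<m. B (i - m) l * u l else 0)"

lemma graph_map_points: "graph_map m k B ` S \<subseteq> points (m + k)"
  by (auto simp: graph_map_def points_def)

lemma graph_map_less: "i < m \<Longrightarrow> graph_map m k B u i = u i"
  by (simp add: graph_map_def)

lemma inj_graph_map: "inj_on (graph_map m k B) (points m)"
proof (rule inj_onI)
  fix u v assume u: "u \<in> points m" "v \<in> points m" "graph_map m k B u = graph_map m k B v"
  show "u = v"
  proof
    fix i show "u i = v i"
      using u graph_map_less[of i m k B] by (cases "i < m") (auto simp: points_def dest: fun_cong[of _ _ i])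
  qed
qed

lemma graph_map_zero: "graph_map m k B (\<lambda>_. 0) = (\<lambda>_. 0)"
  by (auto simp: graph_map_def)

lemma low_degree_graph_map: "low_degree m 1 (\<lambda>u. graph_map m k B u i)"
proof -
  consider "i < m" | "\<not> i < m" "i < m + k" | "\<not> i < m + k" by linarith
  then show ?thesis
  proof cases
    case 1 then show ?thesis using low_degree_coord[of m i] by (simp add: graph_map_def)
  next
    case 2 then show ?thesis
      by (simp add: graph_map_def low_degree_sum low_degree_scale low_degree_coord[unfolded One_nat_def])
  next
    case 3 then show ?thesis by (simp add: graph_map_def low_degree_0)
  qed
qed

text \<open>Flipping \<open>b\<close> at a coordinate where \<open>u\<close> is 1 changes the dot
  product, which pairs the solutions for \<open>v\<close> with those for
  \<open>v + 1\<close>.\<close>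

lemma card_dot_eq:
  assumes u: "u \<in> points m" "u \<noteq> (\<lambda>_. 0)"
  shows "2 * card {b \<in> points m. (\<Sum>l<m. b l * u l) = v} = 2 ^ m"
proof -
  obtain a where a: "u a = 1" using u(2) by (auto simp: fun_eq_iff)
  then have am: "a < m" using u(1) by (force simp: points_def not_le[symmetric])
  define S where "S v = {b \<in> points m. (\<Sum>l<m. b l * u l) = v}" for v
  define f where "f b = b(a := b a + 1)" for b :: "nat \<Rightarrow> bit"
  have ff: "f (f b) = b" for b by (auto simp: f_def fun_eq_iff add.assoc)
  have dot: "(\<Sum>l<m. f b l * u l) = (\<Sum>l<m. b l * u l) + 1" for b
  proof -
    have "(\<Sum>l<m. f b l * u l) = (\<Sum>l<m. b l * u l + (if l = a then 1 else 0))"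
      using a by (intro sum.cong) (auto simp: f_def distrib_right)
    then show ?thesis using am by (simp add: sum.distrib)
  qed
  have pts: "f b \<in> points m" if "b \<in> points m" for b
    using that am by (auto simp: f_def points_def)
  have "bij_betw f (S v) (S (v + 1))"
    by (rule bij_betw_byWitness[where f' = f]) (auto simp: S_def ff dot pts add.assoc)
  then have eq: "card (S v) = card (S (v + 1))" by (rule bij_betw_same_card)
  have "points m = S v \<union> S (v + 1)"
    by (cases v) (auto simp: S_def)
  moreover have "S v \<inter> S (v + 1) = {}" by (cases v) (auto simp: S_def)
  moreover have "finite (S w)" for w by (simp add: S_def)
  ultimately have "card (points m) = card (S v) + card (S (v + 1))"
    by (metis card_Un_disjoint)
  then show ?thesis using eq by (simp add: card_points S_def)
qed

definition slope_matrices :: "nat \<Rightarrow> nat \<Rightarrow> (nat \<Rightarrow> nat \<Rightarrow> bit) set" where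
  "slope_matrices m k = {..<k} \<rightarrow>\<^sub>E points m"

lemma finite_slope_matrices: "finite (slope_matrices m k)"
  unfolding slope_matrices_def by (intro finite_PiE) auto

lemma card_slope_matrices: "card (slope_matrices m k) = (2 ^ m) ^ k"
  by (simp add: slope_matrices_def card_PiE card_points)

text \<open>The first \<open>m\<close> coordinates of \<open>x\<close> fix its only possible
  preimage \<open>u\<close>. Each of the other \<open>k\<close> coordinates is then a linear
  equation on one row of \<open>B\<close>, satisfied by half of all rows when \<open>u\<close> is
  nonzero.\<close>

lemma card_graphs_through:
  "real (card {B \<in> slope_matrices m k. x \<in> graph_map m k B ` (points m - {\<lambda>_. 0})}) \<le> real (card (slope_matrices m k)) / 2 ^ k"
proof -
  define u where "u = (\<lambda>i. if i < m then x i else 0)"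
  let ?T = "{B \<in> slope_matrices m k. x \<in> graph_map m k B ` (points m - {\<lambda>_. 0})}"
  let ?S = "\<lambda>j. {b \<in> points m. (\<Sum>l<m. b l * u l) = x (m + j)}"
  have eq: "v = u" if "v \<in> points m" "x = graph_map m k B v" for v B
    using that by (auto simp: u_def points_def graph_map_def fun_eq_iff)
  show ?thesis
  proof (cases "u = (\<lambda>_. 0)")
    case True
    then have T: "?T = {}" using eq by blast
    show ?thesis unfolding T by simp
  next
    case False
    have u: "u \<in> points m" by (simp add: u_def points_def)
    have half: "real (card (?S j)) = 2 ^ m / 2" for j
      using arg_cong[OF card_dot_eq[OF u False, of "x (m + j)"], of real]
      by simp
    have "?T \<subseteq> Pi\<^sub>E {..<k} ?S"
    proof
      fix B assume B: "B \<in> ?T"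
      then obtain v where v: "v \<in> points m" "x = graph_map m k B v" by auto
      have "v = u" using v by (rule eq)
      then have "(\<Sum>l<m. B j l * u l) = x (m + j)" if "j < k" for j
        using v(2) that by (simp add: graph_map_def)
      then show "B \<in> Pi\<^sub>E {..<k} ?S" using B by (auto simp: slope_matrices_def PiE_iff)
    qed
    then have "card ?T \<le> card (Pi\<^sub>E {..<k} ?S)"
      by (intro card_mono finite_PiE) auto
    also have "\<dots> = (\<Prod>j<k. card (?S j))" by (simp add: card_PiE)
    finally have "real (card ?T) \<le> (\<Prod>j<k. real (card (?S j)))"
      by (simp only: of_nat_prod[symmetric] of_nat_le_iff)
    also have "\<dots> = real (card (slope_matrices m k)) / 2 ^ k"
      by (simp add: half card_slope_matrices power_divide)
    finally show ?thesis .
  qed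
qed

context
  fixes \<delta> \<kappa> :: real and m k r :: nat
  assumes \<delta>: "0 < \<delta>" "\<delta> < 1"
    and \<kappa>: "0 < \<kappa>" "\<kappa> \<le> bexp \<delta> (points m) (soft_dec \<delta> (points m) (reed_muller m r) (\<lambda>_. 0))"
begin

definition local_vote :: "(nat \<Rightarrow> nat \<Rightarrow> bit) \<Rightarrow> ((nat \<Rightarrow> bit) \<Rightarrow> bit) \<Rightarrow> real" where
  "local_vote B z =
     soft_dec \<delta> (points m) (reed_muller m r) (\<lambda>_. 0) (restrict (z \<circ> graph_map m k B) (points m))"

definition vote :: "((nat \<Rightarrow> bit) \<Rightarrow> bit) \<Rightarrow> real" where
  "vote z = (\<Sum>B\<in>slope_matrices m k. local_vote B z)"

lemmas rm = finite_points \<delta> linear_code_reed_muller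

lemma local_vote_cadd:
  assumes "x \<in> reed_muller (m + k) r"
  shows "local_vote B (cadd (points (m + k)) z x) = bsgn (x (\<lambda>_. 0)) * local_vote B z"
proof -
  have "restrict (x \<circ> graph_map m k B) (points m) \<in> reed_muller m r"
    by (rule reed_muller_comp[OF assms graph_map_points low_degree_graph_map])
  then show ?thesis
    unfolding local_vote_def restrict_cadd_comp[OF graph_map_points]
    by (subst soft_dec_cadd[OF rm]) (simp_all add: graph_map_zero)
qed

lemma vote_cadd:
  "x \<in> reed_muller (m + k) r \<Longrightarrow> vote (cadd (points (m + k)) z x) = bsgn (x (\<lambda>_. 0)) * vote z"
  by (simp add: vote_def local_vote_cadd sum_distrib_left)

text \<open>Points off the graph are never read, and at the origin the soft decision ignores its own
  symbol. The origin lies on every graph, so its exclusion is what keeps the overlap count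
  small.\<close>

lemma local_vote_upd:
  assumes "i \<notin> graph_map m k B ` (points m - {\<lambda>_. 0})"
  shows "local_vote B (z(i := v)) = local_vote B z"
proof (cases "i = (\<lambda>_. 0)")
  case False
  have "graph_map m k B u \<noteq> i" if "u \<in> points m" for u
    using assms that False graph_map_zero[of m k B] by (cases "u = (\<lambda>_. 0)") auto
  then have "restrict (z(i := v) \<circ> graph_map m k B) (points m) = restrict (z \<circ> graph_map m k B) (points m)"
    by (auto simp: fun_eq_iff)
  then show ?thesis by (simp only: local_vote_def)
next
  case True
  have "graph_map m k B u \<noteq> (\<lambda>_. 0)" if "u \<in> points m" "u \<noteq> (\<lambda>_. 0)" for u
    using inj_onD[OF inj_graph_map, of m k B u "\<lambda>_. 0"] that by (auto simp: graph_map_zero)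
  then have "restrict (z(i := v) \<circ> graph_map m k B) (points m)
      = (restrict (z \<circ> graph_map m k B) (points m))((\<lambda>_. 0) := v)"
    using True by (intro ext) (auto simp: graph_map_zero)
  then show ?thesis by (simp add: local_vote_def soft_dec_def)
qed

text \<open>With \<open>N\<close> voters of mean \<open>c\<close> and variance at most 1, overlaps
  of at most \<open>N / 2 ^ k\<close> voters bound the variance of the sum by
  \<open>N^2 / 2 ^ k\<close>, against the squared mean \<open>(N * c)^2\<close>.\<close>

lemma vote_error:
  "bexp \<delta> (points (m + k)) (\<lambda>z. if vote z \<le> 0 then 1 else 0) \<le> 1 / (2 ^ k * \<kappa>\<^sup>2)"
proof -
  let ?I = "points (m + k)" and ?N = "real (card (slope_matrices m k))"
  define c where "c = bexp \<delta> (points m) (soft_dec \<delta> (points m) (reed_muller m r) (\<lambda>_. 0))"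
  have c: "\<kappa> \<le> c" "0 < c" using \<kappa> by (auto simp: c_def)
  have N: "?N > 0" by (simp add: card_slope_matrices)
  have mean: "bexp \<delta> ?I vote = ?N * c"
  proof -
    have "bexp \<delta> ?I (local_vote B) = c" for B
      unfolding local_vote_def c_def
      by (rule bexp_pullback) (simp_all add: inj_graph_map graph_map_points)
    then show ?thesis unfolding vote_def bexp_sum by simp
  qed
  have "bvar \<delta> ?I vote \<le> (?N / 2 ^ k) * (\<Sum>B\<in>slope_matrices m k. bvar \<delta> ?I (local_vote B))"
    unfolding vote_def
    using \<delta> local_vote_upd card_graphs_through
    by (intro bvar_sum_le[where D = "\<lambda>B. graph_map m k B ` (points m - {\<lambda>_. 0})"]) (auto simp: finite_slope_matrices)
  also have "\<dots> \<le> (?N / 2 ^ k) * (\<Sum>B\<in>slope_matrices m k. 1)"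
  proof (intro mult_left_mono sum_mono)
    fix B
    have "bvar \<delta> ?I (local_vote B) \<le> bexp \<delta> ?I (\<lambda>z. (local_vote B z)\<^sup>2)"
      by (simp add: bvar_def)
    also have "\<dots> \<le> bexp \<delta> ?I (\<lambda>_. 1)"
      using \<delta> abs_soft_dec_le[OF rm] by (intro bexp_mono) (auto simp: local_vote_def abs_square_le_1)
    finally show "bvar \<delta> ?I (local_vote B) \<le> 1" by (simp add: bexp_const)
  qed simp
  finally have var: "bvar \<delta> ?I vote \<le> ?N\<^sup>2 / 2 ^ k" by (simp add: power2_eq_square)
  have "bexp \<delta> ?I (\<lambda>z. if vote z \<le> 0 then 1 else 0) \<le> bvar \<delta> ?I vote / (bexp \<delta> ?I vote)\<^sup>2"
    using \<delta> N c by (intro bexp_nonpos_le) (auto simp: mean)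
  also have "\<dots> \<le> (?N\<^sup>2 / 2 ^ k) / (?N * c)\<^sup>2"
    unfolding mean using var by (intro divide_right_mono) auto
  also have "\<dots> = 1 / (2 ^ k * c\<^sup>2)" using N by (simp add: power_mult_distrib)
  also have "\<dots> \<le> 1 / (2 ^ k * \<kappa>\<^sup>2)"
    using c \<kappa> by (intro divide_left_mono mult_left_mono power_mono) auto
  finally show ?thesis .
qed

end

section \<open>From the vote at the origin to the conditional entropy\<close>

lemma probZ_eq_bprob: "probZ \<delta> m = bprob \<delta> (points m)"
  by (simp add: probZ_def bprob_def fun_eq_iff)

text \<open>Translating by \<open>p\<close> turns the vote at the origin into a vote at
  \<open>p\<close> with the same equivariance and error probability, as
  \<open>cond_entropy_le_bin_entropy\<close> demands.\<close>

lemma a_entropy_le_of_soft_dec: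
  assumes \<delta>: "0 < \<delta>" "\<delta> < 1"
    and \<kappa>: "0 < \<kappa>" "\<kappa> \<le> bexp \<delta> (points m) (soft_dec \<delta> (points m) (reed_muller m r) (\<lambda>_. 0))"
    and t: "1 / (2 ^ k * \<kappa>\<^sup>2) \<le> 1 / 2"
  shows "a_entropy \<delta> (m + k) r \<le> 2 ^ (m + k) * bin_entropy (1 / (2 ^ k * \<kappa>\<^sup>2))"
proof -
  let ?I = "points (m + k)" and ?t = "1 / (2 ^ k * \<kappa>\<^sup>2)"
  let ?R = "\<lambda>p z. restrict (z \<circ> translate p) ?I"
  define G where "G p z = vote \<delta> m k r (?R p z)" for p z
  have "cond_entropy (bprob \<delta> ?I) (?I \<rightarrow>\<^sub>E UNIV) (W_low (m + k) r) (W_high (m + k) r)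
      \<le> real (card ?I) * bin_entropy ?t"
  proof (rule cond_entropy_le_bin_entropy[where G = G and C = "reed_muller (m + k) r"])
    fix p x z assume p: "p \<in> ?I" and x: "x \<in> reed_muller (m + k) r"
    have "vote \<delta> m k r (cadd ?I (?R p z) (?R p x)) = bsgn (?R p x (\<lambda>_. 0)) * vote \<delta> m k r (?R p z)"
      by (rule vote_cadd[OF \<delta> \<kappa> reed_muller_translate[OF x p]])
    then show "G p (cadd ?I z x) = bsgn (x p) * G p z"
      unfolding G_def restrict_cadd_comp[OF translate_points[OF p]] by (simp add: translate_zero)
  next
    fix p assume p: "p \<in> ?I"
    have "bexp \<delta> ?I (\<lambda>z. if G p z \<le> 0 then 1 else 0) = bexp \<delta> ?I (\<lambda>z. if vote \<delta> m k r z \<le> 0 then 1 else 0)"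
      unfolding G_def
      by (rule bexp_pullback[where F = "\<lambda>z. if vote \<delta> m k r z \<le> 0 then 1 else 0"])
        (simp_all add: inj_translate translate_points[OF p])
    then show "bexp \<delta> ?I (\<lambda>z. if G p z \<le> 0 then 1 else 0) \<le> ?t"
      using vote_error[OF \<delta> \<kappa>] by simp
  qed (use assms inj_on_W W_high_eq_imp_cadd_reed_muller in auto)
  then show ?thesis by (simp add: a_entropy_def probZ_eq_bprob configs_def card_points)
qed

text \<open>Translations act transitively on positions, so the averaged bound
  \<open>soft_dec_mean_ge\<close> holds at the origin.\<close>

lemma soft_dec_reed_muller_mean:
  assumes \<delta>: "0 < \<delta>" "\<delta> < 1/2"
    and \<kappa>: "0 < \<kappa>" "\<kappa> \<le> ln 2 * (1 - bin_entropy \<delta> - real (binom_le m r) / 2 ^ m)"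
  shows "\<kappa> \<le> bexp \<delta> (points m) (soft_dec \<delta> (points m) (reed_muller m r) (\<lambda>_. 0))"
proof -
  let ?I = "points m" and ?C = "reed_muller m r"
  define e where "e = bexp \<delta> ?I (soft_dec \<delta> ?I ?C (\<lambda>_. 0))"
  have \<delta>1: "\<delta> < 1" using \<delta> by simp
  note rm = finite_points \<delta>(1) \<delta>1 linear_code_reed_muller
  have sym: "bexp \<delta> ?I (soft_dec \<delta> ?I ?C p) = e" if p: "p \<in> ?I" for p
  proof -
    have "soft_dec \<delta> ?I ?C (\<lambda>_. 0) (restrict (z \<circ> translate p) ?I) = soft_dec \<delta> ?I ?C p z" for z
      using soft_dec_permute[OF rm translate_points[OF p] inj_translate reed_muller_translate[OF _ p], of r "\<lambda>_. 0" z]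
      by (simp add: translate_zero)
    then have "bexp \<delta> ?I (soft_dec \<delta> ?I ?C p) = bexp \<delta> ?I (\<lambda>z. soft_dec \<delta> ?I ?C (\<lambda>_. 0) (restrict (z \<circ> translate p) ?I))"
      by simp
    also have "\<dots> = e"
      unfolding e_def by (rule bexp_pullback) (simp_all add: inj_translate translate_points[OF p])
    finally show ?thesis .
  qed
  have "ln (real (card ?C)) \<le> ln (2 ^ binom_le m r)"
  proof (subst ln_le_cancel_iff)
    show "0 < real (card ?C)" using code_card_pos[OF rm] by simp
    show "real (card ?C) \<le> 2 ^ binom_le m r"
      using card_reed_muller_le[of m r] by (simp only: of_nat_le_iff[symmetric, where 'a = real] of_nat_power of_nat_numeral)
  qed simp
  then have "2 ^ m * ln 2 * (1 - bin_entropy \<delta>) - real (binom_le m r) * ln 2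
      \<le> real (card ?I) * ln 2 * (1 - bin_entropy \<delta>) - ln (real (card ?C))"
    by (simp add: card_points ln_realpow)
  also have "\<dots> \<le> (1 - 2 * \<delta>) * (\<Sum>p\<in>?I. bexp \<delta> ?I (soft_dec \<delta> ?I ?C p))"
    by (rule soft_dec_mean_ge[OF rm])
  also have "\<dots> = 2 ^ m * ((1 - 2 * \<delta>) * e)"
    by (simp add: sym card_points)
  also have "2 ^ m * ln 2 * (1 - bin_entropy \<delta>) - real (binom_le m r) * ln 2
      = 2 ^ m * (ln 2 * (1 - bin_entropy \<delta> - real (binom_le m r) / 2 ^ m))"
    by (simp add: field_simps)
  finally have "ln 2 * (1 - bin_entropy \<delta> - real (binom_le m r) / 2 ^ m) \<le> (1 - 2 * \<delta>) * e"
    by simp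
  then have k: "\<kappa> \<le> (1 - 2 * \<delta>) * e" using \<kappa>(2) by linarith
  \<comment> \<open>Positivity of \<open>e\<close> allows the factor
    \<open>1 - 2 * \<delta>\<close>, which is below 1, to be dropped.\<close>
  then have "0 < (1 - 2 * \<delta>) * e" using \<kappa>(1) by linarith
  then have "0 < e" using \<delta> by (simp add: zero_less_mult_iff)
  then have "(1 - 2 * \<delta>) * e \<le> e" using \<delta> by (simp add: mult_le_cancel_right2)
  then show ?thesis using k by (simp add: e_def)
qed

section \<open>Asymptotics\<close>

lemma bin_entropy_nonneg:
  assumes "0 < \<delta>" "\<delta> < 1"
  shows "0 \<le> bin_entropy \<delta>"
proof -
  have "\<delta> * log 2 \<delta> \<le> 0" "(1 - \<delta>) * log 2 (1 - \<delta>) \<le> 0"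
    using assms by (auto intro!: mult_nonneg_nonpos)
  then show ?thesis by (simp add: bin_entropy_def)
qed

text \<open>Gibbs' inequality against the fair coin; \<open>ln x \<le> x - 1\<close> is strict at
  \<open>x = 1 / (2 * \<delta>)\<close> because this is not 1.\<close>

lemma bin_entropy_less_1:
  assumes "0 < \<delta>" "\<delta> < 1/2"
  shows "bin_entropy \<delta> < 1"
proof -
  have "ln (1 / (2 * \<delta>)) \<le> 1 / (2 * \<delta>) - 1"
    using assms by (intro ln_le_minus_one) auto
  moreover have "ln (1 / (2 * \<delta>)) \<noteq> 1 / (2 * \<delta>) - 1"
    using assms ln_eq_minus_one[of "1 / (2 * \<delta>)"] by auto
  ultimately have "\<delta> * ln (1 / (2 * \<delta>)) < \<delta> * (1 / (2 * \<delta>) - 1)"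
    using assms by (intro mult_strict_left_mono) auto
  moreover have "(1 - \<delta>) * ln (1 / (2 * (1 - \<delta>))) \<le> (1 - \<delta>) * (1 / (2 * (1 - \<delta>)) - 1)"
    using assms by (intro mult_left_mono ln_le_minus_one) auto
  moreover have "\<delta> * (1 / (2 * \<delta>) - 1) + (1 - \<delta>) * (1 / (2 * (1 - \<delta>)) - 1) = 0"
    using assms by (simp add: field_simps)
  moreover have "\<delta> * ln (1 / (2 * \<delta>)) + (1 - \<delta>) * ln (1 / (2 * (1 - \<delta>))) = ln 2 * (bin_entropy \<delta> - 1)"
  proof -
    have "ln 2 * bin_entropy \<delta> = - \<delta> * ln \<delta> - (1 - \<delta>) * ln (1 - \<delta>)"
      by (simp add: bin_entropy_def log_def field_simps)
    moreover have "ln (1 / (2 * \<delta>)) = - ln 2 - ln \<delta>" "ln (1 / (2 * (1 - \<delta>))) = - ln 2 - ln (1 - \<delta>)"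
      using assms by (simp_all only: ln_div ln_mult_pos) simp_all
    ultimately show ?thesis by (simp only: right_diff_distrib) (simp add: algebra_simps)
  qed
  ultimately have "ln 2 * (bin_entropy \<delta> - 1) < 0" by linarith
  then show ?thesis by (simp add: mult_less_0_iff)
qed

lemma bin_entropy_le_sqrt:
  assumes t: "0 < t" "t \<le> 1/2"
  shows "bin_entropy t \<le> 5 * sqrt t"
proof -
  have s: "0 < sqrt t" using t by simp
  have "- ln t = 2 * ln (1 / sqrt t)"
    using t by (simp add: ln_div ln_sqrt)
  also have "\<dots> \<le> 2 * (1 / sqrt t - 1)"
    using s by (intro mult_left_mono ln_le_minus_one) auto
  also have "\<dots> \<le> 2 / sqrt t" by simp
  finally have "t * (- ln t) \<le> t * (2 / sqrt t)" using t by (intro mult_left_mono) auto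
  also have "\<dots> = 2 * (t / sqrt t)" by simp
  also have "t / sqrt t = sqrt t" using t by (intro real_div_sqrt) simp
  finally have 1: "- t * ln t \<le> 2 * sqrt t" by simp
  have "- ln (1 - t) = ln (1 / (1 - t))" using t by (simp add: ln_div)
  also have "\<dots> \<le> 1 / (1 - t) - 1" using t by (intro ln_le_minus_one) auto
  finally have "(1 - t) * (- ln (1 - t)) \<le> (1 - t) * (1 / (1 - t) - 1)"
    using t by (intro mult_left_mono) auto
  also have "\<dots> = t" using t by (simp add: field_simps)
  also have "t \<le> sqrt t" using t by (simp add: real_le_rsqrt power2_eq_square mult_left_le)
  finally have 2: "- ((1 - t) * ln (1 - t)) \<le> sqrt t" by simp
  have "bin_entropy t * ln 2 = - t * ln t - (1 - t) * ln (1 - t)"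
    by (simp add: bin_entropy_def log_def field_simps)
  also have "\<dots> \<le> 3 * sqrt t" using 1 2 by simp
  \<comment> \<open>The factor 5 converts nats to bits: \<open>ln 2 \<ge> 2/3\<close> gives
    \<open>5 * ln 2 \<ge> 10/3 \<ge> 3\<close>.\<close>
  also have "\<dots> \<le> (5 * sqrt t) * ln 2"
    using mult_left_mono[OF ln2_ge_two_thirds, of "5 * sqrt t"] s by simp
  finally show ?thesis by simp
qed

section \<open>Binomial atoms and code rates\<close>

lemma central_binomial_Suc:
  "((2 * Suc n) choose Suc n) = 2 * (Suc (2 * n) choose Suc n)"
  and central_binomial_Suc': "Suc n * (Suc (2 * n) choose Suc n) = Suc (2 * n) * ((2 * n) choose n)"
proof -
  show "Suc n * (Suc (2 * n) choose Suc n) = Suc (2 * n) * ((2 * n) choose n)"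
    using Suc_times_binomial_eq[of "2 * n" n] by simp
  have "(Suc (2 * n) choose n) = (Suc (2 * n) choose Suc n)"
    using binomial_symmetric[of n "Suc (2 * n)"] by (simp add: Suc_diff_le)
  then show "((2 * Suc n) choose Suc n) = 2 * (Suc (2 * n) choose Suc n)"
    by simp
qed

text \<open>Squared so that induction applies: the step reduces to
  \<open>(2 * n + 1) * (2 * n + 3) \<le> 4 * (n + 1)^2\<close>.\<close>

lemma central_binomial_sq_le: "(real ((2 * n) choose n))\<^sup>2 * (2 * real n + 1) \<le> 16 ^ n"
proof (induction n)
  case (Suc n)
  define c where "c = real ((2 * n) choose n)"
  define d where "d = real ((2 * Suc n) choose Suc n)"
  define e where "e = real (Suc (2 * n) choose Suc n)"
  have "real (Suc n) * e = real (Suc (2 * n)) * c"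
    using arg_cong[OF central_binomial_Suc'[of n], of real] by (simp only: of_nat_mult e_def c_def)
  moreover have "d = 2 * e" unfolding d_def e_def central_binomial_Suc by simp
  ultimately have d: "(real n + 1) * d = 2 * (2 * real n + 1) * c"
    by (simp add: algebra_simps)
  have "(real n + 1)\<^sup>2 * (d\<^sup>2 * (2 * real (Suc n) + 1)) = ((real n + 1) * d)\<^sup>2 * (2 * real n + 3)"
    using mult.assoc by (simp add: power_mult_distrib)
  also have "\<dots> = (c\<^sup>2 * (2 * real n + 1)) * (4 * (2 * real n + 1) * (2 * real n + 3))"
    unfolding d by (simp only: power2_eq_square) (simp add: algebra_simps)
  also have "\<dots> \<le> 16 ^ n * (16 * (real n + 1)\<^sup>2)"
  proof (rule mult_mono)
    show "c\<^sup>2 * (2 * real n + 1) \<le> 16 ^ n" using Suc.IH by (simp only: c_def)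
    show "4 * (2 * real n + 1) * (2 * real n + 3) \<le> 16 * (real n + 1)\<^sup>2"
      by (simp add: power2_eq_square algebra_simps)
  qed simp_all
  also have "\<dots> = (real n + 1)\<^sup>2 * 16 ^ Suc n" by simp
  finally show ?case unfolding d_def[symmetric] by (simp add: mult_le_cancel_left)
qed simp

text \<open>The middle coefficient is the largest. For odd \<open>n\<close> it is half the central
  coefficient of the next row, so the normalised values agree and the even case applies.\<close>

lemma binomial_le_sqrt:
  assumes "n \<ge> 1"
  shows "real (n choose j) / 2 ^ n \<le> 1 / sqrt (real n)"
proof -
  have central: "real ((2 * a) choose a) / 2 ^ (2 * a) \<le> 1 / sqrt (2 * real a + 1)" for a
  proof -
    have "(real ((2 * a) choose a) * sqrt (2 * real a + 1))\<^sup>2 \<le> (2 ^ (2 * a))\<^sup>2"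
      using central_binomial_sq_le[of a] by (simp add: power_mult_distrib power_mult[symmetric]) (simp add: power_mult)
    then have "real ((2 * a) choose a) * sqrt (2 * real a + 1) \<le> 2 ^ (2 * a)"
      by (rule power2_le_imp_le) simp
    then show ?thesis by (simp add: field_simps)
  qed
  have max: "real (n choose j) \<le> real (n choose (n div 2))"
    using binomial_maximum[of n j] by simp
  show ?thesis
  proof (cases "even n")
    case True
    then obtain a where a: "n = 2 * a" by blast
    have "real (n choose j) / 2 ^ n \<le> real ((2 * a) choose a) / 2 ^ (2 * a)"
      using max by (simp add: a divide_right_mono)
    also note central[of a]
    also have "1 / sqrt (2 * real a + 1) \<le> 1 / sqrt (real n)"
      using assms a by (intro divide_left_mono) auto
    finally show ?thesis .
  next
    case False
    then obtain a where a: "n = Suc (2 * a)" by (metis oddE Suc_eq_plus1)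
    have "(Suc (2 * a) choose a) = (Suc (2 * a) choose Suc a)"
      using binomial_symmetric[of a "Suc (2 * a)"] by (simp add: Suc_diff_le)
    then have "real (n choose j) / 2 ^ n \<le> real (Suc (2 * a) choose Suc a) / 2 ^ Suc (2 * a)"
      using max by (simp add: a divide_right_mono del: power_Suc)
    also have "\<dots> = real ((2 * Suc a) choose Suc a) / 2 ^ (2 * Suc a)"
      unfolding central_binomial_Suc by (simp add: field_simps)
    also note central[of "Suc a"]
    also have "1 / sqrt (2 * real (Suc a) + 1) \<le> 1 / sqrt (real n)"
      using a by (intro divide_left_mono) auto
    finally show ?thesis .
  qed
qed

text \<open>Summing Pascal's rule gives two copies of row \<open>n\<close>, the shifted one lacking
  its top term.\<close>

lemma binom_le_Suc: "binom_le (Suc n) r + (n choose r) = 2 * binom_le n r"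
  unfolding binom_le_def by (induction r) auto

lemma binom_le_self: "binom_le m m = 2 ^ m"
  by (simp add: binom_le_def choose_row_sum)

text \<open>At fixed degree, each further variable lowers the rate by half a binomial atom.\<close>

lemma rate_le:
  assumes "n \<ge> 1"
  shows "real (binom_le n r) / 2 ^ n \<le> real (binom_le (n + k) r) / 2 ^ (n + k) + real k / (2 * sqrt (real n))"
proof (induction k)
  case (Suc k)
  let ?N = "n + k"
  have "real (binom_le ?N r) = (real (binom_le (Suc ?N) r) + real (?N choose r)) / 2"
    using arg_cong[OF binom_le_Suc[of ?N r], of real] by simp
  then have "real (binom_le ?N r) / 2 ^ ?N
      = real (binom_le (Suc ?N) r) / 2 ^ Suc ?N + real (?N choose r) / 2 ^ ?N / 2"
    by (simp add: field_simps)
  also have "real (?N choose r) / 2 ^ ?N \<le> 1 / sqrt (real ?N)"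
    using assms by (intro binomial_le_sqrt) auto
  also have "1 / sqrt (real ?N) \<le> 1 / sqrt (real n)"
    using assms by (intro divide_left_mono) auto
  finally have "real (binom_le ?N r) / 2 ^ ?N
      \<le> real (binom_le (Suc ?N) r) / 2 ^ Suc ?N + 1 / sqrt (real n) / 2" by simp
  with Suc.IH show ?case by (simp add: add_divide_distrib)
qed simp

text \<open>Taking the least degree whose rate reaches \<open>\<rho>\<close>, the overshoot is at
  most one binomial atom.\<close>

lemma ex_degree_sequence:
  fixes \<rho> :: real
  assumes "\<rho> \<le> 1"
  obtains rt :: "nat \<Rightarrow> nat" where "\<And>m. rt m \<le> m"
    "\<And>m. \<rho> \<le> real (binom_le m (rt m)) / 2 ^ m"
    "\<And>m. m \<ge> 1 \<Longrightarrow> 0 < \<rho> \<Longrightarrow> real (binom_le m (rt m)) / 2 ^ m \<le> \<rho> + 1 / sqrt (real m)"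
proof
  let ?P = "\<lambda>m r. \<rho> * 2 ^ m \<le> real (binom_le m r)"
  define rt where "rt m = (LEAST r. ?P m r)" for m
  have P: "?P m m" for m using assms by (simp add: binom_le_self)
  show "rt m \<le> m" for m unfolding rt_def by (rule Least_le[of "?P m"]) (rule P)
  have Prt: "?P m (rt m)" for m unfolding rt_def by (rule LeastI[of "?P m"]) (rule P)
  then show "\<rho> \<le> real (binom_le m (rt m)) / 2 ^ m" for m by (simp add: field_simps)
  fix m :: nat assume m: "m \<ge> 1" and \<rho>: "0 < \<rho>"
  have "real (binom_le m (rt m)) \<le> \<rho> * 2 ^ m + real (m choose rt m)"
  proof (cases "rt m")
    case 0
    then show ?thesis using \<rho> by (simp add: binom_le_def)
  next
    case (Suc s)
    then have "\<not> ?P m s" using not_less_Least[of s "?P m"] by (simp add: rt_def)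
    then show ?thesis by (simp add: Suc binom_le_def)
  qed
  then have "real (binom_le m (rt m)) / 2 ^ m \<le> (\<rho> * 2 ^ m + real (m choose rt m)) / 2 ^ m"
    by (rule divide_right_mono) simp
  also have "\<dots> = \<rho> + real (m choose rt m) / 2 ^ m" by (simp add: add_divide_distrib)
  also have "\<dots> \<le> \<rho> + 1 / sqrt (real m)" using binomial_le_sqrt[OF m] by simp
  finally show "real (binom_le m (rt m)) / 2 ^ m \<le> \<rho> + 1 / sqrt (real m)" .
qed

text \<open>
  Passing to codimension \<open>k = \<lfloor>\<epsilon> sqrt m\<rfloor>\<close> changes the rate by at most about \<open>\<epsilon>\<close> while it divides the
  error probability by \<open>2^k\<close>; this is where the exponent \<open>sqrt m\<close> comes from.
\<close>
lemma a_entropy_le_powr: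
  assumes \<delta>: "0 < \<delta>" "\<delta> < 1/2" and \<epsilon>: "0 < \<epsilon>"
    and rate: "real (binom_le (m - nat \<lfloor>\<epsilon> * sqrt (real m)\<rfloor>) r) / 2 ^ (m - nat \<lfloor>\<epsilon> * sqrt (real m)\<rfloor>)
        \<le> 1 - bin_entropy \<delta> - 2 * \<epsilon>"
    and km: "nat \<lfloor>\<epsilon> * sqrt (real m)\<rfloor> \<le> m"
    and large1: "1 / (ln 2 * \<epsilon>)\<^sup>2 \<le> 2 powr (\<epsilon> * sqrt (real m) - 2)"
    and large2: "10 / (ln 2 * \<epsilon>) \<le> 2 powr (\<epsilon> / 4 * sqrt (real m))"
  shows "a_entropy \<delta> m r \<le> 2 powr (- (\<epsilon> / 4) * sqrt (real m)) * 2 ^ m"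
proof -
  define k where "k = nat \<lfloor>\<epsilon> * sqrt (real m)\<rfloor>"
  define s where "s = \<epsilon> * sqrt (real m)"
  \<comment> \<open>The rate condition leaves a gap of at least \<open>2 * \<epsilon>\<close> to
    capacity, so \<open>ln 2 * \<epsilon>\<close> is a valid lower bound for the mean bias.\<close>
  define \<kappa> where "\<kappa> = ln 2 * \<epsilon>"
  define t where "t = 1 / (2 ^ k * \<kappa>\<^sup>2)"
  have s0: "0 \<le> s" using \<epsilon> by (simp add: s_def)
  have k: "s - 1 \<le> real k" unfolding k_def s_def[symmetric] using s0 by linarith
  have \<kappa>: "0 < \<kappa>" using \<epsilon> by (simp add: \<kappa>_def)
  have k2: "2 powr (s - 1) \<le> 2 ^ k"
    using k powr_mono[of "s - 1" "real k" 2] by (simp add: powr_realpow)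
  have t0: "0 < t" using \<kappa> by (simp add: t_def)
  have "2 * (1 / \<kappa>\<^sup>2) \<le> 2 * 2 powr (s - 2)" using large1 by (simp add: \<kappa>_def s_def)
  also have "\<dots> = 2 powr (s - 1)" by (simp add: powr_diff)
  also note k2
  finally have t1: "t \<le> 1 / 2" using \<kappa> by (simp add: t_def field_simps)
  have "\<kappa> \<le> bexp \<delta> (points (m - k)) (soft_dec \<delta> (points (m - k)) (reed_muller (m - k) r) (\<lambda>_. 0))"
  proof (rule soft_dec_reed_muller_mean[OF \<delta> \<kappa>])
    have "ln 2 * \<epsilon> \<le> ln 2 * (1 - bin_entropy \<delta> - real (binom_le (m - k) r) / 2 ^ (m - k))"
      using rate \<epsilon> unfolding k_def by (intro mult_left_mono) auto
    then show "\<kappa> \<le> ln 2 * (1 - bin_entropy \<delta> - real (binom_le (m - k) r) / 2 ^ (m - k))"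
      by (simp add: \<kappa>_def)
  qed
  then have "a_entropy \<delta> (m - k + k) r \<le> 2 ^ (m - k + k) * bin_entropy t"
    unfolding t_def using \<delta> \<kappa> t1 by (intro a_entropy_le_of_soft_dec) (auto simp: t_def)
  then have "a_entropy \<delta> m r \<le> 2 ^ m * bin_entropy t" using km by (simp add: k_def)
  also have "\<dots> \<le> 2 ^ m * (5 * sqrt t)" using bin_entropy_le_sqrt[OF t0 t1] by simp
  also have "5 * sqrt t \<le> 2 powr (- (s / 4))"
  proof -
    have "t \<le> 1 / (2 powr (s - 1) * \<kappa>\<^sup>2)"
      unfolding t_def using k2 \<kappa> by (intro divide_left_mono mult_right_mono) auto
    \<comment> \<open>Weakening the exponent \<open>s - 1\<close> to \<open>s - 2\<close> gives the
      clean exponent \<open>s / 2 - 1\<close> after the square root.\<close>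
    also have "\<dots> \<le> 1 / (2 powr (s - 2) * \<kappa>\<^sup>2)"
      using \<kappa> by (intro divide_left_mono mult_right_mono) auto
    also have "\<dots> = (1 / (2 powr (s / 2 - 1) * \<kappa>))\<^sup>2"
      by (simp add: power_mult_distrib power_divide powr_power algebra_simps)
    finally have "sqrt t \<le> 1 / (2 powr (s / 2 - 1) * \<kappa>)"
      using \<kappa> by (simp add: real_le_lsqrt)
    also have "\<dots> = 2 powr (1 - s / 2) / \<kappa>"
      using powr_minus_divide[of 2 "s / 2 - 1"] by simp
    also have "2 powr (1 - s / 2) = 2 * 2 powr (- (s / 2))"
      using powr_add[of 2 1 "- (s / 2)"] by simp
    finally have "5 * sqrt t \<le> (10 / \<kappa>) * 2 powr (- (s / 2))" by simp
    \<comment> \<open>Half of the exponent \<open>s / 2\<close> is spent on absorbing the constant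
      \<open>10 / \<kappa>\<close>; this yields the rate \<open>\<epsilon> / 4\<close>.\<close>
    also have "\<dots> \<le> 2 powr (s / 4) * 2 powr (- (s / 2))"
      using large2 by (intro mult_right_mono) (auto simp: \<kappa>_def s_def)
    also have "\<dots> = 2 powr (- (s / 4))" by (simp flip: powr_add)
    finally show ?thesis .
  qed
  finally show ?thesis by (simp add: s_def mult.commute)
qed

theorem theorem7p5:
  fixes \<delta> :: real
  assumes "0 < \<delta>" and "\<delta> < 1/2"
  shows "\<forall>d::real. d > 0 \<longrightarrow>
           (\<exists>rt :: nat \<Rightarrow> nat. \<exists>c::real. c > 0 \<and> (\<forall>m. rt m \<le> m) \<and>
              (\<exists>L. (\<lambda>m. real (binom_le m (rt m)) / 2 ^ m) \<longlonglongrightarrow> L \<and>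
                   L \<ge> (1 - d) * (1 - bin_entropy \<delta>)) \<and>
              (\<forall>\<^sub>F m in sequentially.
                   a_entropy \<delta> m (rt m) \<le> 2 powr (- c * sqrt (real m)) * 2 ^ m))"
proof (intro allI impI)
  fix d :: real assume d: "d > 0"
  define h where "h = bin_entropy \<delta>"
  have h: "0 \<le> h" "h < 1"
    using bin_entropy_nonneg[of \<delta>] bin_entropy_less_1[of \<delta>] assms by (auto simp: h_def)
  \<comment> \<open>Capping \<open>d\<close> at 1/2 keeps the target rate positive when
    \<open>d \<ge> 1\<close>; it stays strictly below capacity because \<open>d > 0\<close>.\<close>
  define \<rho> where "\<rho> = (1 - min d (1/2)) * (1 - h)"
  have \<rho>: "0 < \<rho>" "(1 - d) * (1 - h) \<le> \<rho>" using h by (auto simp: \<rho>_def intro!: mult_right_mono)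
  have "\<rho> < 1 * (1 - h)" unfolding \<rho>_def using h d by (intro mult_strict_right_mono) auto
  then have \<rho>h: "\<rho> < 1 - h" by simp
  then obtain rt :: "nat \<Rightarrow> nat" where rt: "\<And>m. rt m \<le> m"
    "\<And>m. \<rho> \<le> real (binom_le m (rt m)) / 2 ^ m"
    "\<And>m. m \<ge> 1 \<Longrightarrow> 0 < \<rho> \<Longrightarrow> real (binom_le m (rt m)) / 2 ^ m \<le> \<rho> + 1 / sqrt (real m)"
    using ex_degree_sequence[of \<rho>] h by auto
  \<comment> \<open>Of the four quarters of the gap, one pays for rounding the degree, one for
    passing to the subspace, and two remain as the slack required by
    \<open>a_entropy_le_powr\<close>.\<close>
  define \<epsilon> where "\<epsilon> = (1 - h - \<rho>) / 4"
  have gap: "\<rho> + 2 * \<epsilon> = 1 - bin_entropy \<delta> - 2 * \<epsilon>" by (simp add: \<epsilon>_def h_def field_simps)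
  have \<epsilon>: "0 < \<epsilon>" "\<epsilon> \<le> 1 / 4" using \<rho>h h \<rho> by (auto simp: \<epsilon>_def)
  have "(\<lambda>m. real (binom_le m (rt m)) / 2 ^ m) \<longlonglongrightarrow> \<rho>"
  proof (rule tendsto_sandwich)
    show "\<forall>\<^sub>F m in sequentially. \<rho> \<le> real (binom_le m (rt m)) / 2 ^ m" using rt(2) by simp
    show "\<forall>\<^sub>F m in sequentially. real (binom_le m (rt m)) / 2 ^ m \<le> \<rho> + 1 / sqrt (real m)"
      using eventually_ge_at_top[of 1] by eventually_elim (use rt(3) \<rho> in auto)
    show "(\<lambda>m. \<rho> + 1 / sqrt (real m)) \<longlonglongrightarrow> \<rho>" by real_asymp
  qed simp
  moreover have "\<forall>\<^sub>F m in sequentially. a_entropy \<delta> m (rt m) \<le> 2 powr (- (\<epsilon> / 4) * sqrt (real m)) * 2 ^ m"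
  proof -
    have "filterlim (\<lambda>m. 2 powr (\<epsilon> * sqrt (real m) - 2)) at_top sequentially"
      using \<epsilon>(1) by real_asymp
    then have "\<forall>\<^sub>F m in sequentially. 1 / (ln 2 * \<epsilon>)\<^sup>2 \<le> 2 powr (\<epsilon> * sqrt (real m) - 2)"
      by (simp add: filterlim_at_top)
    moreover have "filterlim (\<lambda>m. 2 powr (\<epsilon> / 4 * sqrt (real m))) at_top sequentially"
      using \<epsilon>(1) by real_asymp
    then have "\<forall>\<^sub>F m in sequentially. 10 / (ln 2 * \<epsilon>) \<le> 2 powr (\<epsilon> / 4 * sqrt (real m))"
      by (simp add: filterlim_at_top)
    moreover have "\<forall>\<^sub>F m in sequentially. 1 / sqrt (real m) < \<epsilon>"
    proof -
      have "(\<lambda>m. 1 / sqrt (real m)) \<longlonglongrightarrow> 0" by real_asymp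
      then show ?thesis using \<epsilon>(1) by (rule order_tendstoD)
    qed
    ultimately show ?thesis using eventually_ge_at_top[of 1]
    proof eventually_elim
      case (elim m)
      let ?k = "nat \<lfloor>\<epsilon> * sqrt (real m)\<rfloor>"
      have "0 \<le> \<epsilon> * sqrt (real m)" using \<epsilon> by simp
      then have k: "real ?k \<le> \<epsilon> * sqrt (real m)" by linarith
      have "sqrt (real m) \<le> real m"
        using elim(4) by (intro real_le_lsqrt) (auto simp: power2_eq_square)
      then have "\<epsilon> * sqrt (real m) \<le> (1 / 4) * real m" using \<epsilon> by (intro mult_mono) auto
      then have km4: "real ?k \<le> real m / 4" using k by simp
      then have km: "?k \<le> m" by linarith
      have ge1: "1 \<le> m - ?k" using km4 elim(4) by linarith
      \<comment> \<open>Keeping at least a quarter of the dimensions gives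
        \<open>sqrt m \<le> 2 * sqrt (m - k)\<close>, so the loss in \<open>rate_le\<close> is at
        most \<open>\<epsilon>\<close>.\<close>
      have "real m / 4 \<le> real (m - ?k)" using km km4 by (simp add: of_nat_diff)
      then have "sqrt (real m / 4) \<le> sqrt (real (m - ?k))" by (rule real_sqrt_le_mono)
      then have sq: "sqrt (real m) \<le> 2 * sqrt (real (m - ?k))" by (simp add: real_sqrt_divide)
      have "real ?k / (2 * sqrt (real (m - ?k))) \<le> \<epsilon>"
      proof -
        have "real ?k \<le> \<epsilon> * (2 * sqrt (real (m - ?k)))"
          using k mult_left_mono[OF sq, of \<epsilon>] \<epsilon>(1) by linarith
        then show ?thesis using ge1 by (simp add: divide_le_eq)
      qed
      moreover have "real (binom_le (m - ?k) (rt m)) / 2 ^ (m - ?k)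
          \<le> real (binom_le m (rt m)) / 2 ^ m + real ?k / (2 * sqrt (real (m - ?k)))"
        using rate_le[OF ge1, of "rt m" ?k] km by simp
      ultimately have "real (binom_le (m - ?k) (rt m)) / 2 ^ (m - ?k) \<le> 1 - bin_entropy \<delta> - 2 * \<epsilon>"
        using rt(3)[OF elim(4) \<rho>(1)] elim(3) gap by linarith
      then show ?case
        using a_entropy_le_powr[OF assms \<epsilon>(1) _ km elim(1,2)] by simp
    qed
  qed
  ultimately show "\<exists>rt :: nat \<Rightarrow> nat. \<exists>c::real. c > 0 \<and> (\<forall>m. rt m \<le> m) \<and>
      (\<exists>L. (\<lambda>m. real (binom_le m (rt m)) / 2 ^ m) \<longlonglongrightarrow> L \<and> L \<ge> (1 - d) * (1 - bin_entropy \<delta>)) \<and>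
      (\<forall>\<^sub>F m in sequentially. a_entropy \<delta> m (rt m) \<le> 2 powr (- c * sqrt (real m)) * 2 ^ m)"
    using rt(1) \<epsilon>(1) \<rho>(2) unfolding h_def
    by (intro exI[of _ rt] exI[of _ "\<epsilon> / 4"] conjI exI[of _ \<rho>]) auto
qed

end
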